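(* Let $\mu=\langle\mu_1,\dots,\mu_d\rangle$ be a composition of $n$ into positive parts. Given a tabloid $T$ of shape $\mu$, the affine evacuation $e(T)$ may be computed as follows: (1) reverse the order of the rows of $T$, obtaining a tabloid of shape $w_0(\mu)=\langle\mu_d,\dots,\mu_1\rangle$; (2) replace each entry $\overline i$ with $\overline{n+1-i}$; (3) apply the combinatorial $R$-matrix $R_{w_0}$ to restore the tabloid to its original shape $\mu$. That is, the tabloid produced by steps (1)–(3) equals $e(T)$.
   Context: **Tabloids.** $[\overline n]$ is the set of residue classes of integers modulo $n$; $\overline i$ is the class of $i$. For a composition $\mu=\langle\mu_1,\dots,\mu_d\rangle$ of $n$ into positive parts, a tabloid of shape $\mu$ is a bijective filling with $[\overline n]$ of the left-aligned diagram with $\mu_i$ boxes in row $i$ (from the top), up to reordering entries within rows; $\mathcal T(\mu)$ is the set of these. $\mathrm{Des}(T)$ is the set of $\overline i$ such that $\overline{i+1}$ lies in a strictly lower row of $T$ than $\overline i$. Tabloids $T,T'$ are related by a Knuth move if $T'$ is obtained from $T$ by exchanging two elements $\overline i$ and $\overline{i+1}$, and $\mathrm{Des}(T)$, $\mathrm{Des}(T')$ are incomparable under inclusion. The move has type $\overline i$ if $\overline i$ is in exactly one of $\mathrm{Des}(T),\mathrm{Des}(T')$ and $\overline{i+1}$ is in exactly the other one. $\mathcal A_\mu$ is the graph on $\mathcal T(\mu)$ whose edges are Knuth moves. $\mathrm{RRSS}(\mu,\overline k)$ is the tabloid with first row $\overline k,\overline{k-1},\dots,\overline{k-\mu_1+1}$,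 second row $\overline{k-\mu_1},\dots,\overline{k-\mu_1-\mu_2+1}$, and so on. **Affine evacuation** is the unique automorphism $e$ of $\mathcal A_\mu$ such that $e(\mathrm{RRSS}(\mu,\overline k))=\mathrm{RRSS}(\mu,\overline{n-k})$ for all $\overline k$ and such that $e$ sends every edge that is a Knuth move of type $\overline k$ to an edge that is a Knuth move of type $\overline{n-k-1}$. **Combinatorial $R$-matrix.** $B^k$ is the set of one-row semistandard tableaux of length $k$ (multisets of size $k$) with entries in $[n]=\{1,\dots,n\}$. The map $R:B^{k_2}\times B^{k_1}\to B^{k_1}\times B^{k_2}$, $(a,b)\mapsto(a',b')$, is: write the multiset union of entries of $a$ and $b$ in increasing order, with a right parenthesis below each entry of $a$ and a left parenthesis below each entry of $b$, where for equal numbers the right parentheses come before the left ones; recursively remove matched pairs (a left parenthesis followed later by a right one with no remaining parentheses between), leaving $\alpha$ right parentheses followed by $\beta$ left ones; replace these by $\beta$ right parentheses followed by $\alpha$ left ones; restore the removed parentheses; $a'$ (resp. $b'$) is the multiset of numbers above right (resp. left) parentheses. On $B^{k_d}\times\cdots\times B^{k_1}$, $R_i$ ($1\le i<d$) applies $R$ to the factors $B^{k_{i+1}}\times B^{k_i}$ and leaves the others alone. The $R_i$ are involutions satisfying the braid relations (Shimozono), so for $\sigma\in\mathfrak S_d$ there is a well-defined map $R_\sigma$ from $B^{k_d}\times\cdots\times B^{k_1}$ to $B^{k_{\sigma(d)}}\times\cdots\times B^{k_{\sigma(1)}}$, the composition of the $R_i$ along an expression of $\sigma$ as a product of simple transpositions.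 A tabloid of shape $\mu$ is identified with $(b_d,\dots,b_1)\in B^{\mu_d}\times\cdots\times B^{\mu_1}$, where $b_i$ is the set of representatives in $[n]$ of the entries of row $i$; this gives maps $R_\sigma$ on tabloids permuting row lengths. $w_0\in\mathfrak S_d$ is the longest element, $w_0(i)=d+1-i$. *)

theory Defs
  imports
    "HOL-Library.FuncSet"
    "HOL-Library.Multiset"
    "HOL-Combinatorics.Permutations"
begin

section \<open>Tabloids and Knuth moves\<close>

text \<open>
  Residue classes modulo \<open>n\<close> are represented by the integers in \<open>{0..<int n}\<close>, so the class of an
  arbitrary integer \<open>i\<close> is \<open>i mod int n\<close>.  A filling up to reordering the entries within rows is the
  list of the sets of entries of its rows, from top to bottom.
\<close>

definition composition :: "nat \<Rightarrow> nat list \<Rightarrow> bool" where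
  "composition n \<mu> \<longleftrightarrow> sum_list \<mu> = n \<and> (\<forall>p\<in>set \<mu>. 0 < p)"

definition tabloids :: "nat \<Rightarrow> nat list \<Rightarrow> int set list set" where
  "tabloids n \<mu> = {T. length T = length \<mu>
     \<and> (\<forall>r<length \<mu>. card (T ! r) = \<mu> ! r)
     \<and> (\<forall>r<length \<mu>. \<forall>s<length \<mu>. r \<noteq> s \<longrightarrow> T ! r \<inter> T ! s = {})
     \<and> \<Union> (set T) = {0..<int n}}"

definition Des :: "nat \<Rightarrow> int set list \<Rightarrow> int set" where
  "Des n T = {i \<in> {0..<int n}. \<exists>r s. r < s \<and> s < length T
     \<and> i \<in> T ! r \<and> (i + 1) mod int n \<in> T ! s}"

definition exchange :: "nat \<Rightarrow> int \<Rightarrow> int set list \<Rightarrow> int set list" where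
  "exchange n i T = map ((`) (transpose i ((i + 1) mod int n))) T"

definition knuth_move :: "nat \<Rightarrow> int set list \<Rightarrow> int set list \<Rightarrow> bool" where
  "knuth_move n T T' \<longleftrightarrow> (\<exists>i\<in>{0..<int n}. T' = exchange n i T)
     \<and> \<not> Des n T \<subseteq> Des n T' \<and> \<not> Des n T' \<subseteq> Des n T"

definition knuth_move_of_type :: "nat \<Rightarrow> int \<Rightarrow> int set list \<Rightarrow> int set list \<Rightarrow> bool" where
  "knuth_move_of_type n i T T' \<longleftrightarrow> knuth_move n T T' \<and>
     (let j = (i + 1) mod int n in
        (i \<in> Des n T - Des n T' \<and> j \<in> Des n T' - Des n T)
      \<or> (i \<in> Des n T' - Des n T \<and> j \<in> Des n T - Des n T'))"

text \<open>The edge set of the graph on \<open>tabloids n \<mu>\<close>; being a Knuth move is a symmetric relation.\<close>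

definition knuth_edges :: "nat \<Rightarrow> nat list \<Rightarrow> int set list set set" where
  "knuth_edges n \<mu> =
     {{T, T'} | T T'. T \<in> tabloids n \<mu> \<and> T' \<in> tabloids n \<mu> \<and> knuth_move n T T'}"

definition graph_automorphism :: "'a set \<Rightarrow> 'a set set \<Rightarrow> ('a \<Rightarrow> 'a) \<Rightarrow> bool" where
  "graph_automorphism V E e \<longleftrightarrow> bij_betw e V V
     \<and> (\<forall>u\<in>V. \<forall>v\<in>V. {u, v} \<in> E \<longleftrightarrow> {e u, e v} \<in> E)"

section \<open>Affine evacuation\<close>

definition RRSS :: "nat \<Rightarrow> nat list \<Rightarrow> int \<Rightarrow> int set list" where
  "RRSS n \<mu> k = map (\<lambda>r. (\<lambda>j. (k - int j) mod int n)
       ` {sum_list (take r \<mu>)..<sum_list (take (Suc r) \<mu>)}) [0..<length \<mu>]"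

definition is_affine_evacuation ::
    "nat \<Rightarrow> nat list \<Rightarrow> (int set list \<Rightarrow> int set list) \<Rightarrow> bool" where
  "is_affine_evacuation n \<mu> e \<longleftrightarrow>
     graph_automorphism (tabloids n \<mu>) (knuth_edges n \<mu>) e
     \<and> (\<forall>k\<in>{0..<int n}. e (RRSS n \<mu> k) = RRSS n \<mu> ((int n - k) mod int n))
     \<and> (\<forall>k\<in>{0..<int n}. \<forall>T\<in>tabloids n \<mu>. \<forall>T'\<in>tabloids n \<mu>.
          knuth_move_of_type n k T T'
            \<longrightarrow> knuth_move_of_type n ((int n - k - 1) mod int n) (e T) (e T'))"

text \<open>
  Only the values on \<open>tabloids n \<mu>\<close> matter; \<open>extensional\<close> pins down the remaining ones, so that
  uniqueness of the automorphism is uniqueness of the function.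
\<close>

definition affine_evacuation :: "nat \<Rightarrow> nat list \<Rightarrow> int set list \<Rightarrow> int set list" where
  "affine_evacuation n \<mu> =
     (THE e. e \<in> extensional (tabloids n \<mu>) \<and> is_affine_evacuation n \<mu> e)"

section \<open>The combinatorial R-matrix\<close>

datatype paren = RP | LP

text \<open>
  The entries of \<open>a\<close> (labelled with right parentheses) and of \<open>b\<close> (labelled with left parentheses) in
  increasing order.
\<close>

definition paren_word :: "int multiset \<Rightarrow> int multiset \<Rightarrow> (int \<times> paren) list" where
  "paren_word a b = concat (map (\<lambda>x. replicate (count a x) (x, RP) @ replicate (count b x) (x, LP))
     (sorted_list_of_set (set_mset (a + b))))"

text \<open>
  What is left of a word after recursively removing matched pairs: processing the word from its right
  end, a left parenthesis is removed together with the next remaining one if that is a right one.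
\<close>

fun unmatched :: "('a \<times> paren) list \<Rightarrow> ('a \<times> paren) list" where
  "unmatched [] = []"
| "unmatched (p # ps) = (case unmatched ps of
       [] \<Rightarrow> [p]
     | q # qs \<Rightarrow> if snd p = LP \<and> snd q = RP then qs else p # q # qs)"

definition numbers_above :: "paren \<Rightarrow> (int \<times> paren) multiset \<Rightarrow> int multiset" where
  "numbers_above c M = image_mset fst (filter_mset (\<lambda>p. snd p = c) M)"

text \<open>
  The multiset \<open>w - u\<close> consists of the restored matched parentheses, which keep their labels.
\<close>

definition R_matrix :: "int multiset \<times> int multiset \<Rightarrow> int multiset \<times> int multiset" where
  "R_matrix = (\<lambda>(a, b).
     let w = paren_word a b;
         u = unmatched w;
         \<alpha> = length (filter (\<lambda>p. snd p = RP) u);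
         \<beta> = length (filter (\<lambda>p. snd p = LP) u);
         u' = zip (map fst u) (replicate \<beta> RP @ replicate \<alpha> LP);
         M = (mset w - mset u) + mset u'
     in (numbers_above RP M, numbers_above LP M))"

text \<open>
  A tensor \<open>(b\<^sub>d, \<dots>, b\<^sub>1)\<close> is stored as the list \<open>[b\<^sub>1, \<dots>, b\<^sub>d]\<close>, i.e. \<open>b\<^sub>i\<close> sits at list
  index \<open>i - 1\<close>.
\<close>

definition R_simple :: "nat \<Rightarrow> int multiset list \<Rightarrow> int multiset list" where
  "R_simple i bs = (let (a', b') = R_matrix (bs ! i, bs ! (i - 1)) in bs[i := a', i - 1 := b'])"

definition simple_product :: "nat list \<Rightarrow> nat \<Rightarrow> nat" where
  "simple_product ws = foldr (\<lambda>i \<tau>. transpose i (i + 1) \<circ> \<tau>) ws id"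

text \<open>
  If \<open>R\<^sub>i\<close> is applied to a tensor with row lengths \<open>k\<close>, the result has row lengths \<open>k \<circ> s\<^sub>i\<close>.  Hence
  for the result to have row lengths \<open>k \<circ> \<sigma>\<close> with \<open>\<sigma> = s\<^bsub>i1\<^esub> \<circ> \<dots> \<circ> s\<^bsub>im\<^esub>\<close>, the map of the
  leftmost transposition is applied first.  The definite description expresses that the result does
  not depend on the chosen expression of \<open>\<sigma>\<close>.
\<close>

definition R_perm :: "(nat \<Rightarrow> nat) \<Rightarrow> int multiset list \<Rightarrow> int multiset list" where
  "R_perm \<sigma> bs = (THE cs. \<exists>ws. set ws \<subseteq> {1..<length bs} \<and> simple_product ws = \<sigma>
     \<and> cs = fold R_simple ws bs)"

text \<open>The identification of tabloids with tensors, via representatives in \<open>{1..int n}\<close>.\<close>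

definition tabloid_to_tensor :: "nat \<Rightarrow> int set list \<Rightarrow> int multiset list" where
  "tabloid_to_tensor n T = map (\<lambda>S. mset_set ((\<lambda>x. (x - 1) mod int n + 1) ` S)) T"

definition tensor_to_tabloid :: "nat \<Rightarrow> int multiset list \<Rightarrow> int set list" where
  "tensor_to_tabloid n bs = map (\<lambda>M. (\<lambda>x. x mod int n) ` set_mset M) bs"

definition R_tabloid :: "nat \<Rightarrow> (nat \<Rightarrow> nat) \<Rightarrow> int set list \<Rightarrow> int set list" where
  "R_tabloid n \<sigma> T = tensor_to_tabloid n (R_perm \<sigma> (tabloid_to_tensor n T))"

text \<open>The longest element of the symmetric group on \<open>{1..d}\<close>.\<close>

definition w\<^sub>0 :: "nat \<Rightarrow> nat \<Rightarrow> nat" where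
  "w\<^sub>0 d i = (if i \<in> {1..d} then d + 1 - i else i)"

definition complement_entries :: "nat \<Rightarrow> int set list \<Rightarrow> int set list" where
  "complement_entries n T = map ((`) (\<lambda>i. (int n + 1 - i) mod int n)) T"

end

theory Submission
  imports Defs
begin

text \<open>
  A tabloid of shape \<open>\<mu>\<close> is a word written on a cycle: position \<open>i\<close> carries the index of the row that
  contains \<open>i\<close>.  Cut at \<open>k\<close> and read downwards, the cycle becomes a linear word of content \<open>\<mu>\<close>
  (\<open>tabloid_of\<close>); moving the cut one step is a rotation of the word, and \<open>RRSS\<close> is the weakly
  increasing word.  A descent of the tabloid is a place of strict decrease of the word, and a Knuth
  move of type \<open>p\<close> is an elementary Knuth relation on the three letters at \<open>p\<close>, \<open>p + 1\<close>, \<open>p + 2\<close> (for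
  \<open>n \<ge> 3\<close>; in the smaller cases every tabloid is an \<open>RRSS\<close>).

  \<^bold>\<open>Uniqueness.\<close>  By Knuth relations and rotations every word can be made weakly increasing
  (\<open>row_steps_sorted\<close>), so every tabloid is joined by Knuth moves to some \<open>RRSS\<close>
  (\<open>RRSS_connected\<close>).  For \<open>n \<ge> 3\<close> there is at most one move of each type from a given
  tabloid (\<open>window_move_unique\<close>).  Hence an automorphism with prescribed values on the \<open>RRSS\<close> and
  prescribed effect on types is determined along such a path (\<open>affine_evacuation_unique\<close>).

  \<^bold>\<open>Existence.\<close>  On words, the combinatorial \<open>R\<close>-matrix of two neighbouring rows is the
  Lascoux-Schuetzenberger reflection: match each letter \<open>a + 1\<close> with a later \<open>a\<close> like parentheses and
  exchange the two multiplicities of the unmatched letters (\<open>R_simple_tensor_of\<close>).  This rule is cyclic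
  (\<open>reflect_rotate\<close>), it keeps descents (\<open>descent_reflect\<close>), and it carries a Knuth relation on three
  letters to one in the same place (\<open>reflect_window\<close>).  Reversing the rows and complementing the
  entries is the reverse-complement of the word with \<open>k\<close> replaced by \<open>- k\<close>
  (\<open>complement_tabloid_of\<close>).  So for any expression \<open>ws\<close> of \<open>w\<^sub>0\<close> by simple
  transpositions, steps (1) to (3) along \<open>ws\<close> form an affine evacuation
  (\<open>evacuation_is_affine_evacuation\<close>).

  Uniqueness now gives more than the value of \<open>e\<close>: all expressions of \<open>w\<^sub>0\<close> produce the same tabloid,
  since each produces the unique affine evacuation.  This is why \<open>R_perm\<close> is well defined here.
\<close>

section \<open>Knuth relations and rotations of words\<close>

text \<open>
  The elementary Knuth relations, with both directions listed so that the relation is symmetric: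
  in each of them exactly one of the two adjacent pairs is a strict descent, and the relation moves it
  to the other pair.
\<close>

inductive knuth3 :: "nat list \<Rightarrow> nat list \<Rightarrow> bool" where
  yxz: "x < y \<Longrightarrow> y \<le> z \<Longrightarrow> knuth3 [y, x, z] [y, z, x]"
| yzx: "x < y \<Longrightarrow> y \<le> z \<Longrightarrow> knuth3 [y, z, x] [y, x, z]"
| xzy: "x \<le> y \<Longrightarrow> y < z \<Longrightarrow> knuth3 [x, z, y] [z, x, y]"
| zxy: "x \<le> y \<Longrightarrow> y < z \<Longrightarrow> knuth3 [z, x, y] [x, z, y]"

definition knuth_step :: "nat list \<Rightarrow> nat list \<Rightarrow> bool" where
  "knuth_step w w' \<longleftrightarrow> (\<exists>p t t' q. knuth3 t t' \<and> w = p @ t @ q \<and> w' = p @ t' @ q)"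

abbreviation plactic :: "nat list \<Rightarrow> nat list \<Rightarrow> bool" where
  "plactic \<equiv> knuth_step\<^sup>*\<^sup>*"

lemma knuth3_sym: "knuth3 t t' \<Longrightarrow> knuth3 t' t"
  by (auto elim!: knuth3.cases intro: knuth3.intros)

lemma knuth3_mset: "knuth3 t t' \<Longrightarrow> mset t' = mset t"
  by (auto elim!: knuth3.cases)

lemma knuth3_length: "knuth3 t t' \<Longrightarrow> length t = 3 \<and> length t' = 3"
  by (auto elim!: knuth3.cases)

lemma knuth_step_mset: "knuth_step w w' \<Longrightarrow> mset w' = mset w"
  by (auto simp: knuth_step_def dest: knuth3_mset)

lemma knuth_step_context: "knuth_step w w' \<Longrightarrow> knuth_step (p @ w @ q) (p @ w' @ q)"
  unfolding knuth_step_def by (metis append.assoc)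

lemma plactic_context: "plactic w w' \<Longrightarrow> plactic (p @ w @ q) (p @ w' @ q)"
  by (induction rule: rtranclp_induct) (auto dest: knuth_step_context[of _ _ p q])

lemma plactic_append: "plactic w w' \<Longrightarrow> plactic (w @ q) (w' @ q)"
  using plactic_context[of w w' "[]" q] by simp

lemma plactic_prepend: "plactic w w' \<Longrightarrow> plactic (p @ w) (p @ w')"
  using plactic_context[of w w' p "[]"] by simp

lemma plactic_Cons: "plactic w w' \<Longrightarrow> plactic (x # w) (x # w')"
  using plactic_prepend[of w w' "[x]"] by simp

lemma plactic_sym: "plactic w w' \<Longrightarrow> plactic w' w"
proof (induction rule: rtranclp_induct)
  case (step y z)
  then have "knuth_step z y" by (auto simp: knuth_step_def dest: knuth3_sym)
  with step.IH show ?case by (meson converse_rtranclp_into_rtranclp)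
qed simp

lemma plactic_mset: "plactic w w' \<Longrightarrow> mset w' = mset w"
  by (induction rule: rtranclp_induct) (auto dest: knuth_step_mset)

lemma knuth3_plactic: "knuth3 t t' \<Longrightarrow> plactic (t @ q) (t' @ q)"
  by (rule r_into_rtranclp, unfold knuth_step_def) (metis append_Nil)

text \<open>
  Each letter in front of \<open>x\<close> exceeds \<open>x\<close> and is at most the next letter, so \<open>x\<close> can pass to the left
  through \<open>c\<close> by relations \<open>yzx = yxz\<close>.
\<close>

lemma plactic_small_left:
  "sorted (b # c) \<Longrightarrow> x < b \<Longrightarrow> plactic (b # c @ [x]) (b # x # c)"
proof (induction c arbitrary: b)
  case (Cons s c)
  have "plactic (b # (s # c @ [x])) (b # (s # x # c))"
    by (rule plactic_Cons[OF Cons.IH]) (use Cons.prems in auto)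
  also have "plactic (b # (s # x # c)) (b # x # s # c)"
    using knuth3_plactic[OF knuth3.yzx[of x b s], of c] Cons.prems by simp
  finally show ?case by simp
qed simp

text \<open>
  Here \<open>b\<close> is larger than everything in the row, and the letter behind it witnesses each relation
  \<open>xzy = zxy\<close>.
\<close>

lemma plactic_large_left:
  "sorted (a @ [x]) \<Longrightarrow> x < b \<Longrightarrow> plactic (a @ [b, x]) (b # a @ [x])"
proof (induction a arbitrary: x rule: rev_induct)
  case (snoc s a)
  have le: "s \<le> x" "s < b" using snoc.prems by (auto simp: sorted_append)
  have "plactic (a @ [s, b, x]) (a @ [b, s, x])"
    using knuth3_plactic[OF knuth3.xzy[of s x b], of "[]"] snoc.prems le
    by (intro plactic_prepend) simp
  also have "plactic ((a @ [b, s]) @ [x]) ((b # a @ [s]) @ [x])"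
    using snoc le by (intro plactic_append snoc.IH) (auto simp: sorted_append)
  then have "plactic (a @ [b, s, x]) (b # a @ [s] @ [x])" by simp
  finally show ?case by simp
qed simp

text \<open>
  Schensted insertion of \<open>x\<close> into the row \<open>a @ b # c\<close>, where \<open>b\<close> is the letter bumped out: \<open>x\<close> moves
  left through \<open>c\<close>, then \<open>b\<close> moves left through \<open>a\<close>.
\<close>

lemma plactic_bump:
  assumes "sorted (a @ b # c)" "\<forall>s\<in>set a. s \<le> x" "x < b"
  shows "plactic (a @ b # c @ [x]) (b # a @ x # c)"
proof -
  have "plactic (a @ (b # c @ [x])) (a @ (b # x # c))"
    using assms by (intro plactic_prepend plactic_small_left) (auto simp: sorted_append)
  also have "plactic ((a @ [b, x]) @ c) ((b # a @ [x]) @ c)"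
    using assms by (intro plactic_append plactic_large_left) (auto simp: sorted_append)
  then have "plactic (a @ (b # x # c)) (b # a @ x # c)" by simp
  finally show ?thesis .
qed

lemma row_insert:
  assumes "sorted r"
  shows "\<exists>v r'. plactic (r @ [x]) (v @ r') \<and> sorted r' \<and> length r \<le> length r'"
proof (cases "dropWhile (\<lambda>s. s \<le> x) r")
  case Nil
  then have "sorted (r @ [x])" using assms by (auto simp: sorted_append dropWhile_eq_Nil_conv)
  then show ?thesis by (intro exI[of _ "[]"] exI[of _ "r @ [x]"]) auto
next
  case (Cons b c)
  define a where "a = takeWhile (\<lambda>s. s \<le> x) r"
  have r: "r = a @ b # c" using takeWhile_dropWhile_id[of "\<lambda>s. s \<le> x" r] Cons by (simp add: a_def)
  have "x < b" using hd_dropWhile[of "\<lambda>s. s \<le> x" r] Cons by simp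
  moreover have "\<forall>s\<in>set a. s \<le> x" by (auto simp: a_def dest: set_takeWhileD)
  ultimately have "plactic (r @ [x]) ([b] @ (a @ x # c))" "sorted (a @ x # c)"
    using plactic_bump[of a b c x] assms r by (auto simp: sorted_append)
  then show ?thesis using r by (intro exI[of _ "[b]"] exI[of _ "a @ x # c"]) auto
qed

lemma row_insert_word:
  "sorted r \<Longrightarrow> \<exists>v r'. plactic (r @ q) (v @ r') \<and> sorted r' \<and> length r \<le> length r'"
proof (induction q rule: rev_induct)
  case Nil
  then show ?case by (intro exI[of _ "[]"] exI[of _ r]) auto
next
  case (snoc x q)
  then obtain v r' where 1: "plactic (r @ q) (v @ r')" "sorted r'" "length r \<le> length r'" by blast
  obtain v' r'' where 2: "plactic (r' @ [x]) (v' @ r'')" "sorted r''" "length r' \<le> length r''"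
    using row_insert[OF 1(2)] by blast
  have "plactic ((r @ q) @ [x]) ((v @ r') @ [x])" by (rule plactic_append[OF 1(1)])
  also have "plactic (v @ (r' @ [x])) (v @ (v' @ r''))" by (rule plactic_prepend[OF 2(1)])
  then have "plactic ((v @ r') @ [x]) ((v @ v') @ r'')" by simp
  finally show ?case using 1 2 by (intro exI[of _ "v @ v'"] exI[of _ r'']) auto
qed

text \<open>
  The first row of the insertion tableau of \<open>w\<close> has at least \<open>m\<close> boxes, stated without tableaux.
\<close>

definition has_row :: "nat \<Rightarrow> nat list \<Rightarrow> bool" where
  "has_row m w \<longleftrightarrow> (\<exists>v r. plactic w (v @ r) \<and> sorted r \<and> m \<le> length r)"

lemma has_row_mono: "has_row m w \<Longrightarrow> m' \<le> m \<Longrightarrow> has_row m' w"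
  unfolding has_row_def by (meson order.trans)

lemma has_row_plactic: "plactic w w' \<Longrightarrow> has_row m w' \<Longrightarrow> has_row m w"
  unfolding has_row_def by (meson rtranclp_trans)

text \<open>
  Inserting the letters of \<open>q\<close> into the row \<open>r\<close> never makes it shorter.
\<close>

lemma has_row_factor:
  assumes "sorted r" "m \<le> length r"
  shows "has_row m (p @ r @ q)"
proof -
  obtain v r' where r: "plactic (r @ q) (v @ r')" "sorted r'" "length r \<le> length r'"
    using row_insert_word[OF assms(1)] by blast
  then have "plactic (p @ r @ q) ((p @ v) @ r')" using plactic_prepend[OF r(1), of p] by simp
  then show ?thesis unfolding has_row_def using r assms by (meson order.trans)
qed

lemma has_row_append_max:
  assumes "has_row m w" "\<forall>s\<in>set w. s \<le> M"
  shows "has_row (m + c) (w @ replicate c M)"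
proof -
  obtain v r where r: "plactic w (v @ r)" "sorted r" "m \<le> length r"
    using assms(1) by (auto simp: has_row_def)
  have "set r \<subseteq> set w" using plactic_mset[OF r(1)] mset_eq_setD by fastforce
  then have "sorted (r @ replicate c M)" using assms(2) r(2) by (auto simp: sorted_append)
  moreover have "plactic (w @ replicate c M) (v @ (r @ replicate c M))"
    using plactic_append[OF r(1)] by simp
  ultimately show ?thesis unfolding has_row_def using r(3)
    by (intro exI[of _ v] exI[of _ "r @ replicate c M"]) auto
qed

text \<open>
  Rotations are admitted only if the part that stays in place already has a row of length \<open>m\<close>.  This
  is the invariant that survives the induction on the alphabet: without it a row of length \<open>m\<close> could be
  lost along the way.
\<close>

definition row_step :: "nat \<Rightarrow> nat list \<Rightarrow> nat list \<Rightarrow> bool" where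
  "row_step m w w' \<longleftrightarrow> knuth_step w w' \<or> (\<exists>x u. w = x # u \<and> w' = u @ [x] \<and> has_row m u)"

abbreviation row_steps :: "nat \<Rightarrow> nat list \<Rightarrow> nat list \<Rightarrow> bool" where
  "row_steps m \<equiv> (row_step m)\<^sup>*\<^sup>*"

lemma row_step_mset: "row_step m w w' \<Longrightarrow> mset w' = mset w"
  by (auto simp: row_step_def dest: knuth_step_mset)

lemma row_steps_mset: "row_steps m w w' \<Longrightarrow> mset w' = mset w"
  by (induction rule: rtranclp_induct) (auto dest: row_step_mset)

lemma row_steps_mono: "m' \<le> m \<Longrightarrow> row_steps m w w' \<Longrightarrow> row_steps m' w w'"
  unfolding row_step_def by (erule rtranclp_mono[THEN predicate2D, rotated]) (blast intro: has_row_mono)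

lemma plactic_row_steps: "plactic w w' \<Longrightarrow> row_steps m w w'"
  by (erule rtranclp_mono[THEN predicate2D, rotated]) (auto simp: row_step_def)

lemma row_steps_rotate:
  assumes "sorted r" "m \<le> length r"
  shows "row_steps m (v @ p @ r @ q) (p @ r @ q @ v)"
proof (induction v arbitrary: q)
  case (Cons x v)
  have "row_step m (x # v @ p @ r @ q) ((v @ p @ r @ q) @ [x])"
    unfolding row_step_def using has_row_factor[OF assms, of "v @ p" q] by auto
  moreover have "row_steps m (v @ p @ r @ q @ [x]) (p @ r @ (q @ [x]) @ v)" by (rule Cons)
  ultimately show ?case by (simp add: converse_rtranclp_into_rtranclp)
qed simp

text \<open>
  A maximal letter in front of a row can be rotated to the end of the word, where it extends the row.
\<close>

lemma gain_max:
  assumes "sorted r" "m \<le> length r" "\<forall>s\<in>set (v @ p @ r). s \<le> M"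
  shows "\<exists>w'. row_steps m (v @ M # p @ r) w' \<and> has_row (Suc m) w'"
proof -
  have "row_steps m ((v @ [M]) @ p @ r @ []) (p @ r @ [] @ (v @ [M]))"
    by (rule row_steps_rotate[OF assms(1,2)])
  moreover have "has_row (m + 1) ((p @ r @ v) @ replicate 1 M)"
    using assms by (intro has_row_append_max has_row_factor) auto
  ultimately show ?thesis by (intro exI[of _ "p @ r @ v @ [M]"]) auto
qed

text \<open>
  Steps on a word without the maximal letter \<open>M\<close> can be imitated behind its back, with all copies of \<open>M\<close>
  parked at the end.  A Knuth relation is unaffected.  A rotated letter \<open>x\<close> lands behind the copies of
  \<open>M\<close>; if some letter of the row exceeds \<open>x\<close>, then \<open>x\<close> can pass back through them.  Otherwise, if there
  is no \<open>M\<close>, then \<open>x\<close> extends the row; and if there is one, \<open>x\<close> bumps it out of the row while the row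
  keeps its length, and \<open>gain_max\<close> makes the row longer than required.
\<close>

lemma lift_row_step:
  assumes "row_step m U U'" "\<forall>s\<in>set U. s < M"
  shows "row_steps (m + c) (U @ replicate c M) (U' @ replicate c M)
       \<or> (\<exists>w. row_steps (m + c) (U @ replicate c M) w \<and> has_row (Suc (m + c)) w)"
    (is "?L \<or> ?R")
  using assms(1)[unfolded row_step_def]
proof (elim disjE exE conjE)
  assume "knuth_step U U'"
  then have "plactic U U'" by (rule r_into_rtranclp)
  then show ?thesis by (blast intro: plactic_row_steps plactic_append)
next
  fix x u assume U: "U = x # u" "U' = u @ [x]" and "has_row m u"
  then obtain v r where r: "plactic u (v @ r)" "sorted r" "m \<le> length r"
    by (auto simp: has_row_def)
  have "set (v @ r) = set u" using plactic_mset[OF r(1)] mset_eq_setD by blast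
  then have M: "x < M" "\<forall>s\<in>set v. s < M" "\<forall>s\<in>set r. s < M" using assms(2) U by auto
  let ?w = "u @ replicate c M @ [x]"
  have w: "plactic ?w (v @ r @ replicate c M @ [x])" using plactic_append[OF r(1)] by simp
  have "has_row (m + c) (u @ replicate c M)"
    using assms(2) U \<open>has_row m u\<close> by (intro has_row_append_max) auto
  then have "row_step (m + c) (U @ replicate c M) ?w" by (auto simp: row_step_def U)
  then have step: "row_steps (m + c) (U @ replicate c M) w'" if "row_steps (m + c) ?w w'" for w'
    using that by (meson converse_rtranclp_into_rtranclp)
  show ?thesis
  proof (cases "m < length r")
    case True
    then have "has_row (Suc (m + c)) (v @ (r @ replicate c M) @ [x])"
      using r(2) M by (intro has_row_factor) (auto simp: sorted_append less_imp_le)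
    then have "has_row (Suc (m + c)) ?w" using has_row_plactic[OF w] by simp
    then show ?thesis using step by blast
  next
    case False
    then have len: "length r = m" using r(3) by simp
    show ?thesis
    proof (cases "\<forall>s\<in>set r. s \<le> x")
      case all: True
      show ?thesis
      proof (cases c)
        case 0
        have "has_row (Suc (m + c)) (v @ (r @ [x]) @ [])"
          using all r(2) len 0 by (intro has_row_factor) (auto simp: sorted_append)
        then have "has_row (Suc (m + c)) ?w" using has_row_plactic[OF w] 0 by simp
        then show ?thesis using step by blast
      next
        case (Suc c')
        have sorted: "sorted (r @ x # replicate c' M)"
          using all r(2) M by (auto simp: sorted_append less_imp_le)
        have "plactic (r @ M # replicate c' M @ [x]) (M # r @ x # replicate c' M)"
          using all r(2) M by (intro plactic_bump) (auto simp: sorted_append less_imp_le)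
        from plactic_prepend[OF this, of v]
        have "plactic ?w (v @ M # [] @ r @ x # replicate c' M)" using w Suc by (simp add: rtranclp_trans)
        moreover have "\<forall>s\<in>set (v @ [] @ r @ x # replicate c' M). s \<le> M"
          using M by (auto simp: less_imp_le)
        then obtain w' where "row_steps (m + c) (v @ M # [] @ r @ x # replicate c' M) w'"
            "has_row (Suc (m + c)) w'"
          using gain_max[OF sorted, of "m + c" v "[]" M] len Suc by auto
        ultimately show ?thesis using step by (meson plactic_row_steps rtranclp_trans)
      qed
    next
      case ex: False
      then obtain r0 y where ry: "r = r0 @ [y]" by (metis empty_iff list.set(1) rev_exhaust)
      have xy: "x < y" using ex r(2) by (auto simp: ry sorted_append)
      have "plactic (y # replicate c M @ [x]) (y # x # replicate c M)"
        using xy M by (intro plactic_small_left) (auto simp: ry less_imp_le)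
      from plactic_prepend[OF this, of "v @ r0"]
      have "plactic ?w ((v @ r) @ x # replicate c M)" using w by (simp add: ry rtranclp_trans)
      also have "plactic ((v @ r) @ x # replicate c M) (u @ x # replicate c M)"
        by (rule plactic_append[OF plactic_sym[OF r(1)]])
      finally have "row_steps (m + c) ?w (U' @ replicate c M)"
        by (intro plactic_row_steps) (simp add: U)
      then show ?thesis using step by blast
    qed
  qed
qed

lemma lift_row_steps:
  assumes "row_steps m U U'" "\<forall>s\<in>set U. s < M"
  shows "row_steps (m + c) (U @ replicate c M) (U' @ replicate c M)
       \<or> (\<exists>w. row_steps (m + c) (U @ replicate c M) w \<and> has_row (Suc (m + c)) w)"
  using assms(1)
proof (induction rule: rtranclp_induct)
  case (step V V')
  have "\<forall>s\<in>set V. s < M" using row_steps_mset[OF step.hyps(1)] assms(2) mset_eq_setD by blast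
  from lift_row_step[OF step.hyps(2) this, of c] step.IH show ?case by (meson rtranclp_trans)
qed simp

lemma sorted_split_max:
  fixes r :: "nat list"
  shows "sorted r \<Longrightarrow> \<forall>s\<in>set r. s \<le> M \<Longrightarrow> \<exists>r' c. r = r' @ replicate c M \<and> (\<forall>s\<in>set r'. s < M)"
proof (induction r rule: rev_induct)
  case (snoc x r)
  then obtain r' c where r: "r = r' @ replicate c M" "\<forall>s\<in>set r'. s < M" by (auto simp: sorted_append)
  show ?case
  proof (cases "x = M")
    case True
    then show ?thesis using r
      by (intro exI[of _ r'] exI[of _ "Suc c"]) (simp add: replicate_append_same)
  next
    case False
    then have "x < M" using snoc.prems by auto
    then have "\<forall>s\<in>set (r @ [x]). s < M" using snoc.prems by (auto simp: sorted_append)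
    then show ?thesis by (intro exI[of _ "r @ [x]"] exI[of _ 0]) simp
  qed
qed simp

text \<open>
  Induction on the alphabet, with largest letter \<open>M\<close>.  If a copy of \<open>M\<close> lies outside the row,
  \<open>gain_max\<close> applies.  Otherwise the row ends with all copies of \<open>M\<close>: remove them, lengthen the remaining
  row by the induction hypothesis, and lift the steps back with \<open>lift_row_steps\<close>.
\<close>

lemma grow_row:
  "\<lbrakk>\<forall>s\<in>set w. s < M; has_row m w; m < length w\<rbrakk> \<Longrightarrow> \<exists>w'. row_steps m w w' \<and> has_row (Suc m) w'"
proof (induction M arbitrary: w m)
  case (Suc M)
  obtain v r where r: "plactic w (v @ r)" "sorted r" "m \<le> length r"
    using Suc.prems(2) by (auto simp: has_row_def)
  have set: "set (v @ r) = set w" using plactic_mset[OF r(1)] mset_eq_setD by blast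
  then have M: "\<forall>s\<in>set v. s \<le> M" "\<forall>s\<in>set r. s \<le> M" using Suc.prems(1) by (auto simp: less_Suc_eq_le)
  have len: "length (v @ r) = length w" using plactic_mset[OF r(1)] mset_eq_length by blast
  have vr: "row_steps m w w'" if "row_steps m (v @ r) w'" for w'
    using that plactic_row_steps[OF r(1)] by (meson rtranclp_trans)
  consider (long) "m < length r" | (M_in_v) "M \<in> set v" | (rest) "length r = m" "M \<notin> set v"
    using r(3) by linarith
  then show ?case
  proof cases
    case long
    then have "has_row (Suc m) w" using r unfolding has_row_def Suc_le_eq by blast
    then show ?thesis by blast
  next
    case M_in_v
    then obtain v1 v2 where v: "v = v1 @ M # v2" by (meson split_list)
    show ?thesis using gain_max[OF r(2,3), of v1 v2 M] M vr by (auto simp: v)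
  next
    case rest
    obtain r' c where rr: "r = r' @ replicate c M" "\<forall>s\<in>set r'. s < M"
      using sorted_split_max[OF r(2) M(2)] by blast
    define m' where "m' = length r'"
    have m: "m = m' + c" using rest rr by (simp add: m'_def)
    have small: "\<forall>s\<in>set (v @ r'). s < M" using M(1) rest(2) rr(2) by (metis Un_iff le_neq_implies_less set_append)
    have "has_row m' (v @ r')"
      using has_row_factor[of r' m' v "[]"] r(2) rr by (simp add: m'_def sorted_append)
    moreover have "m' < length (v @ r')" using Suc.prems(3) len rest(1) unfolding m'_def length_append by linarith
    ultimately obtain U where U: "row_steps m' (v @ r') U" "has_row (Suc m') U"
      using Suc.IH[OF small] by blast
    have "\<forall>s\<in>set U. s \<le> M"
      using row_steps_mset[OF U(1)] small mset_eq_setD by (metis less_imp_le)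
    from has_row_append_max[OF U(2) this, of c]
    have row: "has_row (Suc m) (U @ replicate c M)" by (simp add: m)
    show ?thesis using lift_row_steps[OF U(1) small, of c] row vr by (auto simp: m rr)
  qed
qed simp

theorem row_steps_sorted: "\<exists>w'. row_steps 0 w w' \<and> sorted w'"
proof -
  have "\<exists>w'. row_steps 0 w w' \<and> has_row m w'" if "m \<le> length w" for m
    using that
  proof (induction m)
    case 0
    have "has_row 0 w" using has_row_factor[of "[]" 0 w "[]"] by simp
    then show ?case by blast
  next
    case (Suc m)
    then obtain w1 where w1: "row_steps 0 w w1" "has_row m w1" by auto
    have "m < length w1" using Suc.prems row_steps_mset[OF w1(1)] mset_eq_length by fastforce
    moreover have "\<forall>s\<in>set w1. s < Suc (Max (set w1))" by (simp add: le_imp_less_Suc)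
    ultimately obtain w2 where "row_steps m w1 w2" "has_row (Suc m) w2"
      using grow_row[of w1 _ m] w1(2) by blast
    then show ?case using w1(1) row_steps_mono[of 0 m] by (meson rtranclp_trans zero_le)
  qed
  then obtain w1 where w1: "row_steps 0 w w1" "has_row (length w) w1" by blast
  then obtain v r where r: "plactic w1 (v @ r)" "sorted r" "length w \<le> length r"
    by (auto simp: has_row_def)
  have "length (v @ r) = length w"
    using plactic_mset[OF r(1)] row_steps_mset[OF w1(1)] by (metis mset_eq_length)
  then have "length v = 0" using r(3) unfolding length_append by linarith
  then show ?thesis using r w1(1) plactic_row_steps[OF r(1)] by (auto intro: rtranclp_trans)
qed

section \<open>Lascoux-Schuetzenberger reflections\<close>

text \<open>
  The letters \<open>a\<close> and \<open>a + 1\<close> are read as parentheses, \<open>a + 1\<close> opening and \<open>a\<close> closing.  After removal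
  of the matched pairs and of all other letters, the remaining word has the form \<open>a \<dots> a (a + 1) \<dots> (a + 1)\<close>
  and its two multiplicities are exchanged.  Generating the relation by insertion of adjacent matched
  pairs and of foreign letters turns the properties below into short inductions.
\<close>

inductive reflection :: "nat \<Rightarrow> nat list \<Rightarrow> nat list \<Rightarrow> bool" for a where
  unmatched: "reflection a (replicate m a @ replicate k (Suc a)) (replicate k a @ replicate m (Suc a))"
| matched: "reflection a (p @ q) (p' @ q') \<Longrightarrow> length p = length p' \<Longrightarrow>
    reflection a (p @ [Suc a, a] @ q) (p' @ [Suc a, a] @ q')"
| other: "reflection a (p @ q) (p' @ q') \<Longrightarrow> length p = length p' \<Longrightarrow> c \<noteq> a \<Longrightarrow> c \<noteq> Suc a \<Longrightarrow>
    reflection a (p @ [c] @ q) (p' @ [c] @ q')"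

lemma reflection_sym: "reflection a w w' \<Longrightarrow> reflection a w' w"
  by (induction rule: reflection.induct) (auto intro: reflection.intros[simplified])

lemma reflection_letters:
  "reflection a w w' \<Longrightarrow> list_all2 (\<lambda>x y. x = y \<or> {x, y} \<subseteq> {a, Suc a}) w w'"
proof (induction rule: reflection.induct)
  case (unmatched m k)
  show ?case by (auto simp: list_all2_conv_all_nth nth_append)
qed (auto simp: list_all2_append)

lemma reflection_length: "reflection a w w' \<Longrightarrow> length w' = length w"
  by (drule reflection_letters, drule list_all2_lengthD) simp

lemma reflection_mset:
  "reflection a w w' \<Longrightarrow> mset w' = image_mset (transpose a (Suc a)) (mset w)"
proof (induction rule: reflection.induct)
  case (unmatched m k)
  show ?case by (simp add: union_commute)
next
  case (matched p q p' q')
  then show ?case by (simp add: add_mset_commute)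
next
  case (other p q p' q' c)
  then have "transpose a (Suc a) c = c" by (simp add: transpose_apply_other)
  with other show ?case by simp
qed

lemma ex_descent_or_sorted_pair:
  assumes "set w \<subseteq> {a, Suc a}"
  shows "(\<exists>m k. w = replicate m a @ replicate k (Suc a)) \<or> (\<exists>p q. w = p @ [Suc a, a] @ q)"
  using assms
proof (induction w)
  case (Cons x w)
  then consider (s) m k where "w = replicate m a @ replicate k (Suc a)" | (d) p q where "w = p @ [Suc a, a] @ q"
    by auto
  then show ?case
  proof cases
    case s
    have x: "x = a \<or> x = Suc a" using Cons.prems by auto
    show ?thesis
    proof (cases "x = a")
      case True
      then have "x # w = replicate (Suc m) a @ replicate k (Suc a)" using s by simp
      then show ?thesis by blast
    next
      case False
      then have "x = Suc a" using x by simp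
      then show ?thesis
      proof (cases m)
        case 0
        then have "x # w = replicate 0 a @ replicate (Suc k) (Suc a)" using s \<open>x = Suc a\<close> by simp
        then show ?thesis by blast
      next
        case (Suc m')
        then have "x # w = [] @ [Suc a, a] @ replicate m' a @ replicate k (Suc a)"
          using s \<open>x = Suc a\<close> by simp
        then show ?thesis by blast
      qed
    qed
  next
    case d
    then have "x # w = (x # p) @ [Suc a, a] @ q" by simp
    then show ?thesis by blast
  qed
qed auto

lemma split_length: "length w = length p + length q \<Longrightarrow> \<exists>p' q'. w = p' @ q' \<and> length p' = length p \<and> length q' = length q"
  by (intro exI[of _ "take (length p) w"] exI[of _ "drop (length p) w"]) auto

text \<open>
  A word in \<open>a\<close> and \<open>a + 1\<close> without the factor \<open>[a + 1, a]\<close> is sorted; any other word becomes shorter by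
  removing such a factor or a foreign letter.
\<close>

lemma reflection_total: "\<exists>w'. reflection a w w'"
proof (induction "length w" arbitrary: w rule: less_induct)
  case less
  have split: "\<exists>p' q'. reflection a (p @ q) (p' @ q') \<and> length p = length p'"
    if len: "length (p @ q) < length w" for p q
  proof -
    obtain u where u: "reflection a (p @ q) u" using less[OF len] by blast
    then have "length u = length p + length q" using reflection_length by fastforce
    then show ?thesis using u split_length by metis
  qed
  show ?case
  proof (cases "set w \<subseteq> {a, Suc a}")
    case True
    then show ?thesis
    proof (rule disjE[OF ex_descent_or_sorted_pair]; elim exE)
      fix m k assume "w = replicate m a @ replicate k (Suc a)"
      then show ?thesis using reflection.unmatched by blast
    next
      fix p q assume "w = p @ [Suc a, a] @ q"
      then show ?thesis using split[of p q] reflection.matched[of a p q] by force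
    qed
  next
    case False
    then obtain c where c: "c \<in> set w" "c \<noteq> a" "c \<noteq> Suc a" by auto
    then obtain p q where w: "w = p @ [c] @ q" by (auto dest: split_list)
    then show ?thesis using split[of p q] reflection.other[of a p q] c(2,3) by force
  qed
qed

text \<open>
  An \<open>a\<close> at the beginning and an \<open>a + 1\<close> at the end are matched around the cycle, and the reflection
  leaves both of them alone although neither is matched in the linear word.
\<close>

lemma reflection_wrap:
  "reflection a w w' \<Longrightarrow> reflection a (a # w @ [Suc a]) (a # w' @ [Suc a])"
proof (induction rule: reflection.induct)
  case (unmatched m k)
  show ?case using reflection.unmatched[of a "Suc m" "Suc k"] by (simp add: replicate_append_same)
next
  case (matched p q p' q')
  then show ?case using reflection.matched[of a "a # p" "q @ [Suc a]" "a # p'" "q' @ [Suc a]"] by simp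
next
  case (other p q p' q' c)
  then show ?case using reflection.other[of a "a # p" "q @ [Suc a]" "a # p'" "q' @ [Suc a]"] by simp
qed

text \<open>
  Rotation changes the linear matching in two ways.  If the first letter opens a matched pair, the pair is
  torn apart, and \<open>reflection_wrap\<close> applies.  If the first letter is an unmatched \<open>a\<close>, it closes the last
  unmatched \<open>a + 1\<close>, if there is one; both letters have the same value before and after the reflection.
\<close>

lemma reflection_rotate1: "reflection a w w' \<Longrightarrow> reflection a (rotate1 w) (rotate1 w')"
proof (induction rule: reflection.induct)
  case (unmatched m k)
  show ?case
  proof (cases m; cases k)
    fix m' k' assume mk: "m = Suc m'" "k = Suc k'"
    have "reflection a ((replicate m' a @ replicate k' (Suc a)) @ [Suc a, a] @ [])
        ((replicate k' a @ replicate m' (Suc a)) @ [Suc a, a] @ [])"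
      by (rule reflection.matched) (simp_all add: reflection.unmatched)
    then show ?thesis by (simp add: mk replicate_append_same replicate_app_Cons_same)
  qed (use reflection.unmatched[of a m 0] reflection.unmatched[of a 0 k] in
      \<open>auto simp: replicate_append_same\<close>)
next
  case (matched p q p' q')
  show ?case
  proof (cases p)
    case Nil
    then show ?thesis using matched reflection_wrap[of a q q'] by simp
  next
    case (Cons x r)
    then obtain x' r' where p': "p' = x' # r'" using matched by (cases p') auto
    then show ?thesis
      using reflection.matched[of a r "q @ [x]" r' "q' @ [x']"] matched Cons by simp
  qed
next
  case (other p q p' q' c)
  show ?case
  proof (cases p)
    case Nil
    then show ?thesis using other reflection.other[of a q "[]" q' "[]" c] reflection_length[of a q q'] by simp
  next
    case (Cons x r)
    then obtain x' r' where p': "p' = x' # r'" using other by (cases p') auto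
    then show ?thesis
      using reflection.other[of a r "q @ [x]" r' "q' @ [x']" c] other Cons by simp
  qed
qed

section \<open>The parenthesis rule computes the reflection\<close>

text \<open>
  The numbers in row \<open>r\<close> of a filling, when letter \<open>j\<close> of \<open>w\<close> is the row index of the number \<open>xs ! j\<close>.
\<close>

definition entries :: "'b list \<Rightarrow> nat list \<Rightarrow> nat \<Rightarrow> 'b multiset" where
  "entries xs w r = mset (map fst (filter (\<lambda>p. snd p = r) (zip xs w)))"

text \<open>
  The parenthesis word of rows \<open>a\<close> and \<open>a + 1\<close>.  It is reversed because the numbers decrease along the
  word of a tabloid, whereas the \<open>R\<close>-matrix reads them increasingly.
\<close>

definition parens :: "nat \<Rightarrow> 'b list \<Rightarrow> nat list \<Rightarrow> ('b \<times> paren) list" where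
  "parens a xs w = rev (map (\<lambda>(x, l). (x, if l = a then LP else RP))
     (filter (\<lambda>p. snd p \<in> {a, Suc a}) (zip xs w)))"

definition reflect_parens :: "('b \<times> paren) list \<Rightarrow> ('b \<times> paren) multiset" where
  "reflect_parens ps = (let u = unmatched ps in
     (mset ps - mset u) + mset (zip (map fst u)
       (replicate (length (filter (\<lambda>p. snd p = LP) u)) RP @
        replicate (length (filter (\<lambda>p. snd p = RP) u)) LP)))"

lemma unmatched_subset: "mset (unmatched ps) \<subseteq># mset ps"
proof (induction ps)
  case IH: (Cons p ps)
  show ?case
  proof (cases "unmatched ps")
    case (Cons q qs)
    then obtain D where D: "mset ps = add_mset q (mset qs) + D"
      using IH.IH by (auto simp: subset_mset.le_iff_add)
    then have "add_mset p (mset ps) = mset qs + ({#p, q#} + D)" by simp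
    then have "mset qs \<subseteq># add_mset p (mset ps)" by (simp only: mset_subset_eq_add_left)
    then show ?thesis using Cons D by simp
  qed simp
qed simp

text \<open>
  The recursion for \<open>unmatched\<close> starts at the right end, so what precedes the pair sees it only through
  the unmatched remainder of the suffix, and a closing parenthesis is never absorbed by that suffix.
\<close>

lemma unmatched_remove: "unmatched (ps @ (x, LP) # (y, RP) # qs) = unmatched (ps @ qs)"
  by (induction ps) (auto split: list.splits)

lemma reflect_parens_remove:
  "reflect_parens (ps @ (x, LP) # (y, RP) # qs) = {#(x, LP), (y, RP)#} + reflect_parens (ps @ qs)"
proof -
  obtain D where "mset (ps @ qs) = mset (unmatched (ps @ qs)) + D"
    using unmatched_subset[of "ps @ qs"] by (auto simp: subset_mset.le_iff_add)
  then have "mset (ps @ (x, LP) # (y, RP) # qs) = mset (unmatched (ps @ qs)) + ({#(x, LP), (y, RP)#} + D)"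
    and "mset (ps @ qs) - mset (unmatched (ps @ qs)) = D" by auto
  then show ?thesis by (simp add: reflect_parens_def unmatched_remove Let_def)
qed

lemma unmatched_replicate:
  "unmatched (zip xs (replicate k RP @ replicate m LP)) = zip xs (replicate k RP @ replicate m LP)"
proof (induction k arbitrary: xs)
  case 0
  have "unmatched (zip xs (replicate m LP)) = zip xs (replicate m LP)" for xs :: "'a list"
  proof (induction m arbitrary: xs)
    case (Suc m)
    show ?case
    proof (cases xs)
      case (Cons x xs')
      have "q \<in> set (zip xs' (replicate m LP)) \<Longrightarrow> snd q = LP" for q
        by (cases q) (auto dest!: set_zip_rightD)
      then show ?thesis using Cons Suc[of xs'] by (auto split: list.splits)
    qed simp
  qed simp
  then show ?case by simp
next
  case (Suc k)
  then show ?case by (cases xs) (auto split: list.splits)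
qed

lemma parens_append:
  "length xs = length v \<Longrightarrow> parens a (xs @ ys) (v @ w) = parens a ys w @ parens a xs v"
  by (simp add: parens_def)

lemma parens_replicate:
  assumes "length xs = m + k"
  shows "parens a xs (replicate m a @ replicate k (Suc a)) = zip (rev xs) (replicate k RP @ replicate m LP)"
proof -
  have 1: "parens a ys (replicate i a) = zip (rev ys) (replicate i LP)" if "length ys = i" for ys :: "'a list" and i
    using that by (simp add: parens_def zip_replicate2 filter_map rev_map o_def)
  have 2: "parens a ys (replicate i (Suc a)) = zip (rev ys) (replicate i RP)" if "length ys = i" for ys :: "'a list" and i
    using that by (simp add: parens_def zip_replicate2 filter_map rev_map o_def)
  have "xs = take m xs @ drop m xs" by simp
  then have "parens a xs (replicate m a @ replicate k (Suc a))
      = parens a (take m xs @ drop m xs) (replicate m a @ replicate k (Suc a))" by simp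
  also have "\<dots> = zip (rev (drop m xs)) (replicate k RP) @ zip (rev (take m xs)) (replicate m LP)"
    using assms by (subst parens_append) (auto simp: 1 2)
  also have "\<dots> = zip (rev (drop m xs) @ rev (take m xs)) (replicate k RP @ replicate m LP)"
    using assms by (subst zip_append) auto
  also have "rev (drop m xs) @ rev (take m xs) = rev xs" by (simp flip: rev_append)
  finally show ?thesis .
qed

lemma filter_zip_replicate:
  assumes "length xs = k + m"
  shows "length (filter (\<lambda>p. snd p = LP) (zip xs (replicate k RP @ replicate m LP))) = m"
    and "length (filter (\<lambda>p. snd p = RP) (zip xs (replicate k RP @ replicate m LP))) = k"
proof -
  have f: "length (filter (\<lambda>p. P (snd p)) (zip xs ys)) = length (filter P ys)"
    if "length xs = length ys" for P :: "paren \<Rightarrow> bool" and ys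
    using that by (induction xs ys rule: list_induct2) auto
  show "length (filter (\<lambda>p. snd p = LP) (zip xs (replicate k RP @ replicate m LP))) = m"
    using f[of "replicate k RP @ replicate m LP" "\<lambda>c. c = LP"] assms by simp
  show "length (filter (\<lambda>p. snd p = RP) (zip xs (replicate k RP @ replicate m LP))) = k"
    using f[of "replicate k RP @ replicate m LP" "\<lambda>c. c = RP"] assms by simp
qed

text \<open>
  The \<open>R\<close>-matrix rule obeys the recursion that defines \<open>reflection\<close>.
\<close>

lemma reflect_parens_reflection:
  "reflection a w w' \<Longrightarrow> length xs = length w \<Longrightarrow> reflect_parens (parens a xs w) = mset (parens a xs w')"
proof (induction arbitrary: xs rule: reflection.induct)
  case (unmatched m k)
  have 1: "map fst (zip (rev xs) (replicate k RP @ replicate m LP)) = rev xs"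
    using unmatched by (intro map_fst_zip) simp
  show ?case using unmatched filter_zip_replicate[of "rev xs" k m]
    by (simp add: reflect_parens_def parens_replicate unmatched_replicate 1 Let_def)
next
  case (matched p q p' q')
  obtain xp xr where x1: "xs = xp @ xr" "length xp = length p" "length xr = length ([Suc a, a] @ q)"
    using split_length[of xs p "[Suc a, a] @ q"] matched.prems by auto
  then obtain x y xq where x2: "xr = x # y # xq" by (auto simp: length_Suc_conv)
  have q: "length q' = length q" using reflection_length[OF matched.hyps(1)] matched.hyps(2) by simp
  have pp: "parens a (x # y # xq) (Suc a # a # v) = parens a xq v @ [(y, LP), (x, RP)]" for v
    by (simp add: parens_def)
  have IH: "reflect_parens (parens a xq q @ parens a xp p) = mset (parens a xq q' @ parens a xp p')"
    using matched.IH[of "xp @ xq"] x1 x2 matched.hyps(2) by (simp add: parens_append)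
  show ?case using x1 x2 q matched.hyps(2)
    by (simp add: parens_append pp reflect_parens_remove IH)
next
  case (other p q p' q' c)
  obtain xp xr where x1: "xs = xp @ xr" "length xp = length p" "length xr = length ([c] @ q)"
    using split_length[of xs p "[c] @ q"] other.prems by auto
  then obtain x xq where x2: "xr = x # xq" by (auto simp: length_Suc_conv)
  have q: "length q' = length q" using reflection_length[OF other.hyps(1)] other.hyps(2) by simp
  have pp: "parens a (x # xq) (c # v) = parens a xq v" for v
    using other.hyps by (simp add: parens_def)
  show ?case using other.IH[of "xp @ xq"] x1 x2 q other.hyps(2)
    by (simp add: parens_append pp)
qed

lemma numbers_above_parens:
  "numbers_above RP (mset (parens a xs w)) = entries xs w (Suc a)"
  "numbers_above LP (mset (parens a xs w)) = entries xs w a"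
proof -
  have "numbers_above c (mset (parens a xs w)) = entries xs w (case c of LP \<Rightarrow> a | RP \<Rightarrow> Suc a)" for c
  proof (induction xs arbitrary: w)
    case (Cons x xs)
    then show ?case
      by (cases w; cases c) (auto simp: numbers_above_def parens_def entries_def)
  qed (simp add: numbers_above_def parens_def entries_def)
  from this[of RP] this[of LP] show "numbers_above RP (mset (parens a xs w)) = entries xs w (Suc a)"
    "numbers_above LP (mset (parens a xs w)) = entries xs w a" by simp_all
qed

lemma entries_other:
  "reflection a w w' \<Longrightarrow> r \<noteq> a \<Longrightarrow> r \<noteq> Suc a \<Longrightarrow> entries xs w r = entries xs w' r"
proof -
  assume "reflection a w w'" and r: "r \<noteq> a" "r \<noteq> Suc a"
  then have "list_all2 (\<lambda>x y. x = y \<or> {x, y} \<subseteq> {a, Suc a}) w w'" by (blast dest: reflection_letters)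
  then show ?thesis
  proof (induction arbitrary: xs rule: list_all2_induct)
    case (Cons y w y' w')
    then show ?case using r by (cases xs) (auto simp: entries_def)
  qed simp
qed

lemma entries_reflection:
  assumes "reflection a w w'" "length xs = length w"
  shows "entries xs w' r =
    (if r = Suc a then numbers_above RP (reflect_parens (parens a xs w))
     else if r = a then numbers_above LP (reflect_parens (parens a xs w))
     else entries xs w r)"
  using assms entries_other[OF assms(1), of r xs]
  by (simp add: reflect_parens_reflection numbers_above_parens)

lemma entries_inject:
  assumes "distinct xs" "length xs = length w" "length xs = length w'" "\<And>r. entries xs w r = entries xs w' r"
  shows "w = w'"
proof (rule nth_equalityI)
  fix j assume j: "j < length w"
  have "xs ! j \<in># entries xs w (w ! j)" using j assms(2)
    by (force simp: entries_def set_zip)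
  then have "xs ! j \<in># entries xs w' (w ! j)" using assms(4) by simp
  then obtain i where "i < length xs" "xs ! i = xs ! j" "w' ! i = w ! j"
    by (auto simp: entries_def set_zip)
  then show "w ! j = w' ! j" using assms(1,2) j by (simp add: nth_eq_iff_index_eq)
qed (use assms in simp)

text \<open>
  The insertions that derive a reflection can be chosen in many ways; since the \<open>R\<close>-matrix rule is a
  function, the result does not depend on them.
\<close>

lemma reflection_unique:
  assumes "reflection a w w'" "reflection a w w''"
  shows "w' = w''"
proof (rule entries_inject)
  show "entries (map int [0..<length w]) w' r = entries (map int [0..<length w]) w'' r" for r
    using entries_reflection[OF assms(1), of "map int [0..<length w]" r]
      entries_reflection[OF assms(2), of "map int [0..<length w]" r] by simp
qed (use assms in \<open>auto simp: distinct_map dest: reflection_length\<close>)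

section \<open>The reflection as a function\<close>

definition reflect :: "nat \<Rightarrow> nat list \<Rightarrow> nat list" where
  "reflect a w = (THE w'. reflection a w w')"

lemma reflection_iff: "reflection a w w' \<longleftrightarrow> w' = reflect a w"
  unfolding reflect_def using reflection_total reflection_unique by (metis the_equality)

lemma reflection_reflect: "reflection a w (reflect a w)"
  by (simp add: reflection_iff)

lemma reflect_reflect [simp]: "reflect a (reflect a w) = w"
  using reflection_sym[OF reflection_reflect] by (simp add: reflection_iff)

lemma length_reflect [simp]: "length (reflect a w) = length w"
  by (rule reflection_length[OF reflection_reflect])

lemma mset_reflect: "mset (reflect a w) = image_mset (transpose a (Suc a)) (mset w)"
  by (rule reflection_mset[OF reflection_reflect])

lemma reflect_rotate: "reflect a (rotate m w) = rotate m (reflect a w)"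
proof -
  have "reflect a (rotate1 w) = rotate1 (reflect a w)" for w
    using reflection_rotate1[OF reflection_reflect] by (simp add: reflection_iff)
  then show ?thesis by (induction m) (simp_all)
qed

lemma reflect_matched: "reflect a (Suc a # a # u) = Suc a # a # reflect a u"
  using reflection.matched[of a "[]" u "[]" "reflect a u"] by (simp add: reflection_iff)

lemma descent_reflect_imp:
  assumes "reflect a (x # y # u) = x' # y' # u'" "y < x"
  shows "y' < x'"
proof (cases "{x, y} \<subseteq> {a, Suc a}")
  case True
  then have "x = Suc a" "y = a" using assms(2) by auto
  then show ?thesis using assms(1) by (simp add: reflect_matched)
next
  case False
  have "list_all2 (\<lambda>x y. x = y \<or> {x, y} \<subseteq> {a, Suc a}) (x # y # u) (x' # y' # u')"
    using reflection_letters[OF reflection_reflect, of a "x # y # u"] assms(1) by simp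
  then show ?thesis using False assms(2) by auto
qed

text \<open>
  A descent from \<open>a + 1\<close> to \<open>a\<close> is a matched pair and stays.  In any other descent one letter is foreign
  and compares in the same way with \<open>a\<close> and with \<open>a + 1\<close>.  No descent is created because the reflection is
  an involution.  For pairs in other places, rotate.
\<close>

lemma descent_reflect:
  assumes "reflect a (x # y # u) = x' # y' # u'"
  shows "y' < x' \<longleftrightarrow> y < x"
  using descent_reflect_imp[OF assms] descent_reflect_imp[of a x' y' u' x y u] assms
  by (metis reflect_reflect)

lemma length_3D: "length w = 3 \<Longrightarrow> \<exists>x y z. w = [x, y, z]"
  by (auto simp: numeral_3_eq_3 length_Suc_conv)

section \<open>Tabloids as cyclic words\<close>

definition rows_of :: "nat \<Rightarrow> nat \<Rightarrow> (int \<Rightarrow> nat) \<Rightarrow> int set list" where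
  "rows_of n d g = map (\<lambda>r. {i \<in> {0..<int n}. g i = r}) [0..<d]"

text \<open>
  Letter \<open>j\<close> of the word sits at position \<open>k - j\<close> of the cycle.  With this direction \<open>RRSS\<close> is the sorted
  word and the descents of the tabloid are the strict descents of the word.
\<close>

definition letter :: "int \<Rightarrow> nat list \<Rightarrow> int \<Rightarrow> nat" where
  "letter k w i = w ! nat ((k - i) mod int (length w))"

definition tabloid_of :: "nat \<Rightarrow> int \<Rightarrow> nat list \<Rightarrow> int set list" where
  "tabloid_of d k w = rows_of (length w) d (letter k w)"

lemma length_rows_of [simp]: "length (rows_of n d g) = d"
  by (simp add: rows_of_def)

lemma nth_rows_of [simp]: "r < d \<Longrightarrow> rows_of n d g ! r = {i \<in> {0..<int n}. g i = r}"
  by (simp add: rows_of_def)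

lemma rows_of_cong: "(\<And>i. 0 \<le> i \<Longrightarrow> i < int n \<Longrightarrow> g i = h i) \<Longrightarrow> rows_of n d g = rows_of n d h"
  by (auto simp: rows_of_def)

lemma rows_of_eqD:
  assumes "rows_of n d g = rows_of n d h" "0 \<le> i" "i < int n" "g i < d"
  shows "g i = h i"
proof -
  have "i \<in> rows_of n d g ! g i" using assms(2-4) by simp
  then show ?thesis using assms(1,4) by simp
qed

lemma Des_rows_of:
  assumes "\<And>i. 0 \<le> i \<Longrightarrow> i < int n \<Longrightarrow> g i < d"
  shows "Des n (rows_of n d g) = {i \<in> {0..<int n}. g i < g ((i + 1) mod int n)}" (is "?L = ?R")
proof (rule set_eqI)
  fix i
  show "i \<in> ?L \<longleftrightarrow> i \<in> ?R"
  proof (cases "i \<in> {0..<int n}")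
    case True
    then have i': "(i + 1) mod int n \<in> {0..<int n}" by simp
    show ?thesis
    proof
      assume "i \<in> ?L"
      then show "i \<in> ?R" by (auto simp: Des_def)
    next
      assume "i \<in> ?R"
      then have "g i < g ((i + 1) mod int n)" by simp
      moreover have "g i < d" "g ((i + 1) mod int n) < d" using assms True i' by auto
      ultimately have "\<exists>r s. r < s \<and> s < length (rows_of n d g) \<and> i \<in> rows_of n d g ! r
          \<and> (i + 1) mod int n \<in> rows_of n d g ! s"
        using True i' by (intro exI[of _ "g i"] exI[of _ "g ((i + 1) mod int n)"]) simp
      then show "i \<in> ?L" using True by (simp add: Des_def)
    qed
  qed (auto simp: Des_def)
qed

lemma exchange_rows_of:
  assumes "i \<in> {0..<int n}"
  shows "exchange n i (rows_of n d g) = rows_of n d (g \<circ> transpose i ((i + 1) mod int n))"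
proof -
  define j where "j = (i + 1) mod int n"
  have j: "j \<in> {0..<int n}" using assms by (simp add: j_def)
  have "transpose i j ` {q \<in> {0..<int n}. g q = r} = {q \<in> {0..<int n}. (g \<circ> transpose i j) q = r}" for r
  proof (rule set_eqI)
    fix q
    have "q \<in> transpose i j ` A \<longleftrightarrow> transpose i j q \<in> A" for A
      by (metis image_iff transpose_involutory)
    moreover have "transpose i j q \<in> {0..<int n} \<longleftrightarrow> q \<in> {0..<int n}"
      using assms j by (auto simp: transpose_def)
    ultimately show "q \<in> transpose i j ` {q \<in> {0..<int n}. g q = r} \<longleftrightarrow>
        q \<in> {q \<in> {0..<int n}. (g \<circ> transpose i j) q = r}" by auto
  qed
  then show ?thesis by (simp add: exchange_def rows_of_def j_def o_def)
qed

lemma nat_mod_eq_iff: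
  assumes "j < n" shows "nat ((k - i) mod int n) = j \<longleftrightarrow> (k - int j) mod int n = i mod int n"
proof -
  have "nat ((k - i) mod int n) = j \<longleftrightarrow> (k - i) mod int n = int j mod int n"
    using assms by auto
  also have "\<dots> \<longleftrightarrow> int n dvd (k - i) - int j" by (rule mod_eq_dvd_iff)
  also have "(k - i) - int j = (k - int j) - i" by simp
  also have "int n dvd (k - int j) - i \<longleftrightarrow> (k - int j) mod int n = i mod int n" by (rule mod_eq_dvd_iff[symmetric])
  finally show ?thesis .
qed

lemma letter_nth: "j < length w \<Longrightarrow> letter k w (k - int j) = w ! j"
  by (simp add: letter_def)

lemma letter_mod: "letter k w (i mod int (length w)) = letter k w i"
  by (simp add: letter_def mod_diff_right_eq)

lemma letter_nth_mod: "j < length w \<Longrightarrow> letter k w ((k - int j) mod int (length w)) = w ! j"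
  by (simp add: letter_mod letter_nth)

lemma letter_in_set: "w \<noteq> [] \<Longrightarrow> letter k w i \<in> set w"
  by (simp add: letter_def nat_less_iff)

lemma residue_bounds: "j < n \<Longrightarrow> 0 \<le> x mod int n" "j < n \<Longrightarrow> x mod int n < int n"
  by simp_all

lemma residueE:
  assumes "0 \<le> i" "i < int n"
  obtains j where "j < n" "i = (k - int j) mod int n"
proof
  have n: "0 < n" using assms by simp
  then show j: "nat ((k - i) mod int n) < n" by (simp add: nat_less_iff)
  show "i = (k - int (nat ((k - i) mod int n))) mod int n"
    using nat_mod_eq_iff[OF j, of k i] assms by simp
qed

lemma residue_inject:
  assumes "(k - int j) mod int n = (k - int j') mod int n" "j < n" "j' < n" shows "j = j'"
  using nat_mod_eq_iff[OF assms(2), of k "k - int j'"] assms by simp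

lemma tabloid_of_shift: "k mod int (length w) = k' mod int (length w) \<Longrightarrow> tabloid_of d k w = tabloid_of d k' w"
  unfolding tabloid_of_def letter_def by (metis mod_diff_left_eq)

lemma tabloid_of_rotate: "tabloid_of d (k - int m) (rotate m w) = tabloid_of d k w"
proof -
  have "letter (k - int m) (rotate m w) i = letter k w i" if "0 \<le> i" "i < int (length w)" for i
  proof -
    define j where "j = nat ((k - int m - i) mod int (length w))"
    have len: "0 < int (length w)" using that by linarith
    then have j: "j < length w" by (simp add: j_def nat_less_iff)
    have "int j = (k - int m - i) mod int (length w)" using len by (simp add: j_def)
    then have "int ((m + j) mod length w) = (int m + (k - int m - i)) mod int (length w)"
      by (simp add: zmod_int mod_add_right_eq)
    also have "\<dots> = (k - i) mod int (length w)" by simp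
    finally have "(m + j) mod length w = nat ((k - i) mod int (length w))" by simp
    then show ?thesis using nth_rotate[OF j, of m] by (simp add: letter_def j_def)
  qed
  then show ?thesis unfolding tabloid_of_def length_rotate by (intro rows_of_cong) simp
qed

lemma tabloid_of_rotate1: "tabloid_of d k (x # u) = tabloid_of d (k - 1) (u @ [x])"
  using tabloid_of_rotate[of d k 1 "x # u"] by simp

lemma tabloid_of_inject:
  assumes "tabloid_of d k w = tabloid_of d k w'" "length w = length w'" "set w \<subseteq> {..<d}"
  shows "w = w'"
proof (rule nth_equalityI)
  fix j assume j: "j < length w"
  let ?i = "(k - int j) mod int (length w)"
  have "w ! j < d" using nth_mem[OF j] assms(3) by blast
  then have "letter k w ?i < d" using letter_nth_mod[OF j] by simp
  then have "letter k w ?i = letter k w' ?i"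
    using assms(1,2) residue_bounds[OF j] unfolding tabloid_of_def
    by (intro rows_of_eqD[of "length w" d "letter k w" "letter k w'" ?i]) simp_all
  then show "w ! j = w' ! j" using letter_nth_mod[of j w k] letter_nth_mod[of j w' k] j assms(2) by simp
qed (rule assms(2))

lemma count_positions: "count (mset w) r = card {j. j < length w \<and> w ! j = r}"
  unfolding count_mset count_list_eq_length_filter length_filter_conv_card by (rule arg_cong[of _ _ card]) auto

lemma card_letter: "card {i \<in> {0..<int (length w)}. letter k w i = r} = count (mset w) r"
proof -
  have "bij_betw (\<lambda>j. (k - int j) mod int (length w)) {j. j < length w \<and> w ! j = r}
      {i \<in> {0..<int (length w)}. letter k w i = r}"
  proof (rule bij_betw_imageI)
    show "inj_on (\<lambda>j. (k - int j) mod int (length w)) {j. j < length w \<and> w ! j = r}"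
      by (rule inj_onI) (auto dest: residue_inject)
    show "(\<lambda>j. (k - int j) mod int (length w)) ` {j. j < length w \<and> w ! j = r} =
        {i \<in> {0..<int (length w)}. letter k w i = r}" (is "?f ` ?A = ?B")
    proof
      show "?f ` ?A \<subseteq> ?B" by (auto simp: letter_nth_mod intro!: pos_mod_sign pos_mod_bound)
      show "?B \<subseteq> ?f ` ?A"
      proof
        fix i assume i: "i \<in> ?B"
        then obtain j where j: "j < length w" "i = ?f j" using residueE[of i "length w" k] by auto
        then have "j \<in> ?A" using i letter_nth_mod[of j w k] by auto
        then show "i \<in> ?f ` ?A" using j(2) by blast
      qed
    qed
  qed
  from bij_betw_same_card[OF this] show ?thesis
    by (simp add: count_positions)
qed

definition row_word :: "nat list \<Rightarrow> nat list" where
  "row_word \<mu> = concat (map (\<lambda>r. replicate (\<mu> ! r) r) [0..<length \<mu>])"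

text \<open>
  The words of content \<open>\<mu>\<close>.
\<close>

definition words :: "nat list \<Rightarrow> nat list set" where
  "words \<mu> = {w. mset w = mset (row_word \<mu>)}"

lemma row_word_snoc: "row_word (\<mu> @ [m]) = row_word \<mu> @ replicate m (length \<mu>)"
proof -
  have "concat (map (\<lambda>r. replicate ((\<mu> @ [m]) ! r) r) [0..<length \<mu>]) = row_word \<mu>"
    unfolding row_word_def by (intro arg_cong[where f = concat] map_cong) (auto simp: nth_append)
  then show ?thesis by (simp add: row_word_def[of "\<mu> @ [m]"])
qed

lemma length_row_word [simp]: "length (row_word \<mu>) = sum_list \<mu>"
  by (induction \<mu> rule: rev_induct) (simp_all add: row_word_snoc, simp add: row_word_def)

lemma set_row_word: "set (row_word \<mu>) \<subseteq> {..<length \<mu>}"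
  by (auto simp: row_word_def)

lemma sorted_row_word: "sorted (row_word \<mu>)"
proof (induction \<mu> rule: rev_induct)
  case (snoc m \<mu>)
  then show ?case using set_row_word[of \<mu>] by (auto simp: row_word_snoc sorted_append less_imp_le)
qed (simp add: row_word_def)

lemma row_word_positions:
  "r < length \<mu> \<Longrightarrow> {j. j < sum_list \<mu> \<and> row_word \<mu> ! j = r} = {sum_list (take r \<mu>)..<sum_list (take (Suc r) \<mu>)}"
proof (induction \<mu> rule: rev_induct)
  case (snoc m \<mu>)
  have low: "row_word \<mu> ! j < length \<mu>" if "j < sum_list \<mu>" for j
    using set_row_word[of \<mu>] nth_mem[of j "row_word \<mu>"] that unfolding length_row_word by blast
  have nth: "row_word (\<mu> @ [m]) ! j = (if j < sum_list \<mu> then row_word \<mu> ! j else length \<mu>)"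
    if "j < sum_list \<mu> + m" for j
    using that by (auto simp: row_word_snoc nth_append)
  show ?case
  proof (cases "r < length \<mu>")
    case True
    have "{j. j < sum_list (\<mu> @ [m]) \<and> row_word (\<mu> @ [m]) ! j = r} = {j. j < sum_list \<mu> \<and> row_word \<mu> ! j = r}"
      using True by (auto simp: nth split: if_splits)
    then show ?thesis using snoc.IH[OF True] True by simp
  next
    case False
    then have r: "r = length \<mu>" using snoc.prems by simp
    have "{j. j < sum_list (\<mu> @ [m]) \<and> row_word (\<mu> @ [m]) ! j = r} = {sum_list \<mu>..<sum_list \<mu> + m}"
      using low by (fastforce simp: nth r split: if_splits)
    then show ?thesis by (simp add: r)
  qed
qed simp

lemma count_row_word: "count (mset (row_word \<mu>)) r = (if r < length \<mu> then \<mu> ! r else 0)"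
proof (cases "r < length \<mu>")
  case True
  have "count (mset (row_word \<mu>)) r = card {j. j < sum_list \<mu> \<and> row_word \<mu> ! j = r}"
    by (simp only: count_positions length_row_word)
  then show ?thesis using True by (simp add: row_word_positions take_Suc_conv_app_nth)
next
  case False
  then show ?thesis using set_row_word[of \<mu>] by (auto simp: count_eq_zero_iff)
qed

lemma words_length: "w \<in> words \<mu> \<Longrightarrow> length w = sum_list \<mu>"
  using mset_eq_length[of w "row_word \<mu>"] by (simp add: words_def)

lemma words_set: "w \<in> words \<mu> \<Longrightarrow> set w \<subseteq> {..<length \<mu>}"
  using set_row_word[of \<mu>] mset_eq_setD[of w "row_word \<mu>"] by (simp add: words_def)

lemma words_mset: "w \<in> words \<mu> \<Longrightarrow> mset w' = mset w \<Longrightarrow> w' \<in> words \<mu>"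
  by (simp add: words_def)

lemma sorted_words: "w \<in> words \<mu> \<Longrightarrow> sorted w \<Longrightarrow> w = row_word \<mu>"
  using properties_for_sort[of w "row_word \<mu>"] sorted_row_word[of \<mu>] by (simp add: words_def sorted_sort_id)

lemma letter_less: "w \<in> words \<mu> \<Longrightarrow> 0 \<le> i \<Longrightarrow> i < int (length w) \<Longrightarrow> letter k w i < length \<mu>"
  using letter_in_set[of w k i] words_set[of w \<mu>] by (cases "w = []") auto

lemma RRSS_row_word: "RRSS (sum_list \<mu>) \<mu> k = tabloid_of (length \<mu>) k (row_word \<mu>)"
  unfolding RRSS_def tabloid_of_def rows_of_def length_row_word
proof (rule map_cong[OF refl])
  fix r assume "r \<in> set [0..<length \<mu>]"
  then have r: "r < length \<mu>" by simp
  let ?n = "sum_list \<mu>" and ?f = "\<lambda>j. (k - int j) mod int (sum_list \<mu>)"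
  let ?A = "{j. j < ?n \<and> row_word \<mu> ! j = r}"
  have "?f ` ?A = {i \<in> {0..<int ?n}. letter k (row_word \<mu>) i = r}" (is "_ = ?B")
  proof
    show "?f ` ?A \<subseteq> ?B" using letter_nth_mod[of _ "row_word \<mu>" k] by (auto intro!: pos_mod_sign pos_mod_bound)
    show "?B \<subseteq> ?f ` ?A"
    proof
      fix i assume i: "i \<in> ?B"
      then obtain j where j: "j < ?n" "i = ?f j" using residueE[of i ?n k] by auto
      then have "j \<in> ?A" using i letter_nth_mod[of j "row_word \<mu>" k] by auto
      then show "i \<in> ?f ` ?A" using j(2) by blast
    qed
  qed
  then show "?f ` {sum_list (take r \<mu>)..<sum_list (take (Suc r) \<mu>)} = ?B"
    by (simp add: row_word_positions[OF r])
qed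

lemma tabloid_of_in_tabloids:
  assumes "w \<in> words \<mu>" shows "tabloid_of (length \<mu>) k w \<in> tabloids (sum_list \<mu>) \<mu>"
proof -
  let ?T = "tabloid_of (length \<mu>) k w"
  note len = words_length[OF assms]
  have rows: "?T ! r = {i \<in> {0..<int (length w)}. letter k w i = r}" if "r < length \<mu>" for r
    using that by (simp add: tabloid_of_def)
  have "card (?T ! r) = \<mu> ! r" if "r < length \<mu>" for r
    using that assms card_letter[of w k r] by (simp add: rows words_def count_row_word)
  moreover have "\<Union> (set ?T) = {0..<int (sum_list \<mu>)}"
    using letter_less[OF assms] len by (auto simp: tabloid_of_def rows_of_def)
  ultimately show ?thesis by (auto simp: tabloids_def rows) (simp add: tabloid_of_def)
qed

lemma tabloid_word:
  assumes "T \<in> tabloids n \<mu>" "sum_list \<mu> = n"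
  shows "\<exists>w\<in>words \<mu>. T = tabloid_of (length \<mu>) k w"
proof -
  let ?d = "length \<mu>"
  have len: "length T = ?d" and card: "\<And>r. r < ?d \<Longrightarrow> card (T ! r) = \<mu> ! r"
    and disj: "\<And>r s. r < ?d \<Longrightarrow> s < ?d \<Longrightarrow> r \<noteq> s \<Longrightarrow> T ! r \<inter> T ! s = {}"
    and Un: "\<Union> (set T) = {0..<int n}"
    using assms(1) by (auto simp: tabloids_def)
  have "\<exists>r<?d. i \<in> T ! r" if "i \<in> {0..<int n}" for i
    using that Un len by (auto simp: set_conv_nth)
  then obtain g where g: "\<And>i. i \<in> {0..<int n} \<Longrightarrow> g i < ?d \<and> i \<in> T ! g i" by metis
  have T: "T = rows_of n ?d g"
  proof (rule nth_equalityI)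
    fix r assume "r < length T"
    then have r: "r < ?d" by (simp add: len)
    have sub: "T ! r \<subseteq> {0..<int n}" using Un r len nth_mem by fastforce
    have "T ! r = {i \<in> {0..<int n}. g i = r}"
      using g disj[OF r] sub by blast
    then show "T ! r = rows_of n ?d g ! r" using r by simp
  qed (simp add: len)
  define w where "w = map (\<lambda>j. g ((k - int j) mod int n)) [0..<n]"
  have lw: "length w = n" by (simp add: w_def)
  have lg: "letter k w i = g i" if i: "0 \<le> i" "i < int n" for i
  proof -
    obtain j where j: "j < n" "i = (k - int j) mod int n" using residueE[OF i] .
    then show ?thesis using letter_nth_mod[of j w k] lw by (simp add: w_def)
  qed
  have Tw: "T = tabloid_of ?d k w"
    unfolding T tabloid_of_def lw by (rule rows_of_cong) (simp add: lg)
  have "count (mset w) r = count (mset (row_word \<mu>)) r" for r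
  proof (cases "r < ?d")
    case True
    then have "T ! r = {i \<in> {0..<int (length w)}. letter k w i = r}"
      by (simp add: Tw tabloid_of_def)
    then have "card (T ! r) = count (mset w) r" by (simp only: card_letter)
    then show ?thesis using card[OF True] True by (simp add: count_row_word)
  next
    case False
    then have "r \<notin> set w" using g by (auto simp: w_def)
    then show ?thesis using False by (simp add: count_row_word count_eq_zero_iff)
  qed
  then have "w \<in> words \<mu>" by (simp add: words_def multiset_eq_iff)
  then show ?thesis using Tw by blast
qed

lemma finite_tabloids: "sum_list \<mu> = n \<Longrightarrow> finite (tabloids n \<mu>)"
proof -
  assume n: "sum_list \<mu> = n"
  have "tabloids n \<mu> \<subseteq> tabloid_of (length \<mu>) 0 ` words \<mu>" using tabloid_word[OF _ n, of _ 0] by blast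
  moreover have "finite (words \<mu>)" unfolding words_def by (rule mset_eq_finite)
  ultimately show ?thesis by (blast intro: finite_subset)
qed

lemma residue_succ: "j < n \<Longrightarrow> ((k - 1 - int j) mod int n + 1) mod int n = (k - int j) mod int n"
  by (subst mod_add_left_eq) simp

lemma residue_Suc: "j < n \<Longrightarrow> (k - 1 - int j) mod int n = (k - int (Suc j mod n)) mod int n"
  by (simp add: zmod_int mod_diff_right_eq algebra_simps)

lemma Des_tabloid_of:
  assumes "w \<in> words \<mu>" "n = length w" "j < n"
  shows "(k - 1 - int j) mod int n \<in> Des n (tabloid_of (length \<mu>) k w) \<longleftrightarrow> w ! (Suc j mod n) < w ! j"
proof -
  have "(k - 1 - int j) mod int n \<in> {0..<int n}" "Suc j mod n < n" using assms(3) by simp_all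
  then show ?thesis
    unfolding tabloid_of_def assms(2)
    using assms letter_less[OF assms(1)] letter_nth_mod[of j w k] letter_nth_mod[of "Suc j mod n" w k]
    by (simp add: Des_rows_of residue_succ) (simp add: residue_Suc)
qed

lemma exchange_tabloid_of:
  assumes "n = length w" "a < n"
  shows "exchange n ((k - 1 - int a) mod int n) (tabloid_of d k w) =
    tabloid_of d k (w[a := w ! (Suc a mod n), Suc a mod n := w ! a])" (is "_ = tabloid_of d k ?w'")
proof -
  let ?b = "Suc a mod n"
  let ?\<tau> = "transpose ((k - int ?b) mod int n) ((k - int a) mod int n)"
  have b: "?b < n" using assms(2) by simp
  have "letter k ?w' i = (letter k w \<circ> ?\<tau>) i" if i: "0 \<le> i" "i < int n" for i
  proof -
    obtain j where j: "j < n" "i = (k - int j) mod int n" using residueE[OF i] .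
    have eq: "(k - int j) mod int n = (k - int c) mod int n \<longleftrightarrow> j = c" if "c < n" for c
      using residue_inject[of k j n c] j(1) that by blast
    define c where "c = (if j = ?b then a else if j = a then ?b else j)"
    have c: "c < n" using j(1) b assms(2) by (simp add: c_def)
    have "?\<tau> i = (k - int c) mod int n"
      unfolding j(2) transpose_def c_def eq[OF b] eq[OF assms(2)] by simp
    then have "(letter k w \<circ> ?\<tau>) i = w ! c"
      using letter_nth_mod[of c w k] c assms(1) by simp
    moreover have "letter k ?w' i = ?w' ! j" using letter_nth_mod[of j ?w' k] j assms(1) by simp
    moreover have "?w' ! j = w ! c" using j(1) assms b by (auto simp: c_def nth_list_update)
    ultimately show ?thesis by simp
  qed
  then have "rows_of n d (letter k ?w') = rows_of n d (letter k w \<circ> ?\<tau>)" by (rule rows_of_cong)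
  moreover have "exchange n ((k - 1 - int a) mod int n) (rows_of n d (letter k w)) = rows_of n d (letter k w \<circ> ?\<tau>)"
    using assms(2) by (subst exchange_rows_of) (simp_all add: residue_succ, simp add: residue_Suc)
  ultimately show ?thesis by (simp add: tabloid_of_def assms(1))
qed

section \<open>Knuth moves and uniqueness of affine evacuation\<close>

text \<open>
  A Knuth relation on the three letters at the positions \<open>k\<close>, \<open>k - 1\<close>, \<open>k - 2\<close>.  Cutting the cycle at the
  window keeps the wrap-around out of sight; for \<open>n \<ge> 3\<close> these are exactly the Knuth moves of type
  \<open>k - 2\<close>.
\<close>

definition window_move :: "nat list \<Rightarrow> int \<Rightarrow> int set list \<Rightarrow> int set list \<Rightarrow> bool" where
  "window_move \<mu> k T T' \<longleftrightarrow> (\<exists>t t' u. t @ u \<in> words \<mu> \<and> knuth3 t t'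
     \<and> T = tabloid_of (length \<mu>) k (t @ u) \<and> T' = tabloid_of (length \<mu>) k (t' @ u))"

lemma words_knuth3: "t @ u \<in> words \<mu> \<Longrightarrow> knuth3 t t' \<Longrightarrow> t' @ u \<in> words \<mu>"
  by (erule words_mset) (auto dest: knuth3_mset)

lemma window_move_sym: "window_move \<mu> k T T' \<Longrightarrow> window_move \<mu> k T' T"
proof -
  assume "window_move \<mu> k T T'"
  then obtain t t' u where 1: "t @ u \<in> words \<mu>" "knuth3 t t'" "T = tabloid_of (length \<mu>) k (t @ u)"
      "T' = tabloid_of (length \<mu>) k (t' @ u)"
    by (auto simp: window_move_def)
  then have "t' @ u \<in> words \<mu>" "knuth3 t' t" using words_knuth3 knuth3_sym by blast+
  then show ?thesis unfolding window_move_def using 1(3,4) by blast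
qed

lemma window_move_tabloids:
  "window_move \<mu> k T T' \<Longrightarrow> T \<in> tabloids (sum_list \<mu>) \<mu> \<and> T' \<in> tabloids (sum_list \<mu>) \<mu>"
  unfolding window_move_def using words_knuth3 tabloid_of_in_tabloids by blast

lemma window_move_large: "window_move \<mu> k T T' \<Longrightarrow> 3 \<le> sum_list \<mu>"
  unfolding window_move_def using words_length knuth3_length by fastforce

lemma knuth3_unique: "knuth3 t s \<Longrightarrow> knuth3 t s' \<Longrightarrow> s = s'"
  by (auto elim!: knuth3.cases)

lemma window_move_unique:
  assumes "window_move \<mu> k T A" "window_move \<mu> k T B" shows "A = B"
proof -
  obtain t t' u where 1: "t @ u \<in> words \<mu>" "knuth3 t t'" "T = tabloid_of (length \<mu>) k (t @ u)"
      "A = tabloid_of (length \<mu>) k (t' @ u)"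
    using assms(1) by (auto simp: window_move_def)
  obtain s s' v where 2: "s @ v \<in> words \<mu>" "knuth3 s s'" "T = tabloid_of (length \<mu>) k (s @ v)"
      "B = tabloid_of (length \<mu>) k (s' @ v)"
    using assms(2) by (auto simp: window_move_def)
  have "t @ u = s @ v"
    using tabloid_of_inject[of "length \<mu>" k "t @ u" "s @ v"] 1 2 words_length words_set by metis
  then have "t = s" "u = v" using knuth3_length[OF 1(2)] knuth3_length[OF 2(2)] by auto
  then show ?thesis using 1 2 knuth3_unique by metis
qed

lemma window_Des:
  assumes "[x, y, z] @ u \<in> words \<mu>" "sum_list \<mu> = n"
  shows "(k - 1) mod int n \<in> Des n (tabloid_of (length \<mu>) k ([x, y, z] @ u)) \<longleftrightarrow> y < x"
    and "(k - 2) mod int n \<in> Des n (tabloid_of (length \<mu>) k ([x, y, z] @ u)) \<longleftrightarrow> z < y"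
proof -
  have n: "n = length ([x, y, z] @ u)" using words_length[OF assms(1)] assms(2) by simp
  show "(k - 1) mod int n \<in> Des n (tabloid_of (length \<mu>) k ([x, y, z] @ u)) \<longleftrightarrow> y < x"
    using Des_tabloid_of[OF assms(1) n, of 0 k] n by simp
  show "(k - 2) mod int n \<in> Des n (tabloid_of (length \<mu>) k ([x, y, z] @ u)) \<longleftrightarrow> z < y"
    using Des_tabloid_of[OF assms(1) n, of 1 k] n by simp
qed

lemma exchange_first:
  assumes "n = length ([x, y, z] @ u)"
  shows "exchange n ((k - 1) mod int n) (tabloid_of d k ([x, y, z] @ u)) = tabloid_of d k ([y, x, z] @ u)"
    and "exchange n ((k - 2) mod int n) (tabloid_of d k ([x, y, z] @ u)) = tabloid_of d k ([x, z, y] @ u)"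
proof -
  show "exchange n ((k - 1) mod int n) (tabloid_of d k ([x, y, z] @ u)) = tabloid_of d k ([y, x, z] @ u)"
    using exchange_tabloid_of[OF assms, of 0 k d] assms by simp
  show "exchange n ((k - 2) mod int n) (tabloid_of d k ([x, y, z] @ u)) = tabloid_of d k ([x, z, y] @ u)"
    using exchange_tabloid_of[OF assms, of 1 k d] assms by (simp add: numeral_2_eq_2)
qed

lemma residue_pred_succ: "((k - 2) mod int n + 1) mod int n = (k - 1) mod int n"
  by (subst mod_add_left_eq) simp

lemma knuth_move_of_type_if_window_move:
  assumes "window_move \<mu> k T T'" "sum_list \<mu> = n"
  shows "knuth_move_of_type n ((k - 2) mod int n) T T'"
proof -
  obtain t t' u where 1: "t @ u \<in> words \<mu>" "knuth3 t t'" "T = tabloid_of (length \<mu>) k (t @ u)"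
      "T' = tabloid_of (length \<mu>) k (t' @ u)"
    using assms(1) by (auto simp: window_move_def)
  have w': "t' @ u \<in> words \<mu>" using words_knuth3 1 by blast
  obtain x y z where t: "t = [x, y, z]" using knuth3_length[OF 1(2)] length_3D by blast
  obtain x' y' z' where t': "t' = [x', y', z']" using knuth3_length[OF 1(2)] length_3D by blast
  have n: "n = length ([x, y, z] @ u)" "0 < n" using words_length[OF 1(1)] assms(2) t by auto
  have "\<exists>i\<in>{0..<int n}. T' = exchange n i T"
  proof -
    have "[x', y', z'] = [y, x, z] \<or> [x', y', z'] = [x, z, y]"
      using 1(2) unfolding t t' by (auto elim!: knuth3.cases)
    then show ?thesis
    proof
      assume "[x', y', z'] = [y, x, z]"
      then have "T' = exchange n ((k - 1) mod int n) T"
        unfolding 1(3,4) t t' exchange_first(1)[OF n(1)] by simp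
      then show ?thesis using n(2) by force
    next
      assume "[x', y', z'] = [x, z, y]"
      then have "T' = exchange n ((k - 2) mod int n) T"
        unfolding 1(3,4) t t' exchange_first(2)[OF n(1)] by simp
      then show ?thesis using n(2) by force
    qed
  qed
  moreover have D: "(k - 1) mod int n \<in> Des n T \<longleftrightarrow> y < x" "(k - 2) mod int n \<in> Des n T \<longleftrightarrow> z < y"
      "(k - 1) mod int n \<in> Des n T' \<longleftrightarrow> y' < x'" "(k - 2) mod int n \<in> Des n T' \<longleftrightarrow> z' < y'"
    using window_Des[OF 1(1)[unfolded t] assms(2), of k] window_Des[OF w'[unfolded t'] assms(2), of k]
    by (simp_all only: 1(3,4) t t')
  have "(y < x \<and> \<not> z < y \<and> \<not> y' < x' \<and> z' < y') \<or> (\<not> y < x \<and> z < y \<and> y' < x' \<and> \<not> z' < y')"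
    using 1(2) unfolding t t' by (auto elim!: knuth3.cases)
  with D have "((k - 2) mod int n \<in> Des n T - Des n T' \<and> (k - 1) mod int n \<in> Des n T' - Des n T)
      \<or> ((k - 2) mod int n \<in> Des n T' - Des n T \<and> (k - 1) mod int n \<in> Des n T - Des n T')" by blast
  ultimately show ?thesis
    unfolding knuth_move_of_type_def knuth_move_def residue_pred_succ Let_def by blast
qed

lemma words_swap:
  assumes "w \<in> words \<mu>" "a < length w" "b < length w"
  shows "w[a := w ! b, b := w ! a] \<in> words \<mu>"
  using words_mset[OF assms(1) mset_swap[OF assms(3,2)]] .

lemma exchange_word:
  assumes "w \<in> words \<mu>" "sum_list \<mu> = n" "i \<in> {0..<int n}"
  obtains a where "a < n" "i = (k - 1 - int a) mod int n" "w[a := w ! (Suc a mod n), Suc a mod n := w ! a] \<in> words \<mu>"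
    "exchange n i (tabloid_of (length \<mu>) k w) =
      tabloid_of (length \<mu>) k (w[a := w ! (Suc a mod n), Suc a mod n := w ! a])"
proof -
  have n: "n = length w" using words_length[OF assms(1)] assms(2) by simp
  have "0 \<le> i" "i < int n" using assms(3) by auto
  then obtain a where a: "a < n" "i = (k - 1 - int a) mod int n" by (rule residueE)
  then have "Suc a mod n < n" by simp
  then show ?thesis using that[OF a] words_swap[OF assms(1)] a exchange_tabloid_of[OF n a(1)] n by auto
qed

text \<open>
  A move of type \<open>p\<close> changes both the descent at \<open>p\<close> and the descent at \<open>p + 1\<close>, so the exchange must meet
  both of the pairs they depend on.  This leaves the two exchanges inside the window and, for \<open>n = 3\<close>, the
  exchange of its two ends; the latter cannot move a descent from one pair to the other.
\<close>

lemma window_move_if_knuth_move_of_type: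
  assumes "knuth_move_of_type n p T T'" "T \<in> tabloids n \<mu>" "sum_list \<mu> = n" "3 \<le> n"
    "p \<in> {0..<int n}"
  shows "window_move \<mu> (p + 2) T T'"
proof -
  define k where "k = p + 2"
  have p: "p = (k - 2) mod int n" using assms(5) by (simp add: k_def)
  obtain w where w: "w \<in> words \<mu>" "T = tabloid_of (length \<mu>) k w"
    using tabloid_word[OF assms(2,3)] by blast
  have n: "length w = n" using words_length[OF w(1)] assms(3) by simp
  obtain x y z u where wu: "w = [x, y, z] @ u"
  proof -
    obtain t u where "w = t @ u" "length t = 3"
      using n assms(4) by (metis append_take_drop_id length_take min.absorb2)
    then show ?thesis using length_3D that by blast
  qed
  obtain i where i: "i \<in> {0..<int n}" "T' = exchange n i T"
    using assms(1) unfolding knuth_move_of_type_def knuth_move_def by blast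
  obtain a where a: "a < n" "w[a := w ! (Suc a mod n), Suc a mod n := w ! a] \<in> words \<mu>"
      "T' = tabloid_of (length \<mu>) k (w[a := w ! (Suc a mod n), Suc a mod n := w ! a])"
    using exchange_word[OF w(1) assms(3) i(1), of k] i(2) w(2) by metis
  define w' where "w' = w[a := w ! (Suc a mod n), Suc a mod n := w ! a]"
  have lw': "length w' = n" by (simp add: w'_def n)
  then obtain x' y' z' u' where wu': "w' = [x', y', z'] @ u'"
  proof -
    obtain t u where "w' = t @ u" "length t = 3"
      using lw' assms(4) by (metis append_take_drop_id length_take min.absorb2)
    then show ?thesis using length_3D that by blast
  qed
  have "knuth_move_of_type n ((k - 2) mod int n) T T'" using assms(1) p by simp
  then have "((k - 2) mod int n \<in> Des n T - Des n T' \<and> (k - 1) mod int n \<in> Des n T' - Des n T)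
      \<or> ((k - 2) mod int n \<in> Des n T' - Des n T \<and> (k - 1) mod int n \<in> Des n T - Des n T')"
    unfolding knuth_move_of_type_def residue_pred_succ Let_def by blast
  moreover have "(k - 1) mod int n \<in> Des n T \<longleftrightarrow> y < x" "(k - 2) mod int n \<in> Des n T \<longleftrightarrow> z < y"
      "(k - 1) mod int n \<in> Des n T' \<longleftrightarrow> y' < x'" "(k - 2) mod int n \<in> Des n T' \<longleftrightarrow> z' < y'"
    using window_Des[OF w(1)[unfolded wu] assms(3), of k] a(2,3)[folded w'_def, unfolded wu']
      window_Des[OF a(2)[folded w'_def, unfolded wu'] assms(3), of k] w(2)[unfolded wu]
    by simp_all
  ultimately have D: "(y < x \<and> \<not> z < y \<and> \<not> y' < x' \<and> z' < y') \<or> (\<not> y < x \<and> z < y \<and> y' < x' \<and> \<not> z' < y')"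
    by blast
  have len_u: "n = Suc (Suc (Suc (length u)))" using n wu by simp
  consider (0) "a = 0" | (1) "a = 1" | (2) "a = 2" "u = []" | (3) "a = 2" "u \<noteq> []" | (4) "3 \<le> a" by linarith
  then have "u' = u \<and> knuth3 [x, y, z] [x', y', z']"
  proof cases
    case 0
    then have "w' = [y, x, z] @ u" by (simp add: w'_def wu len_u)
    then have "[x', y', z'] = [y, x, z]" "u' = u" using wu' by auto
    moreover have "knuth3 [x, y, z] [y, x, z]"
    proof (cases "y < x")
      case True
      then show ?thesis using D calculation(1) by (intro knuth3.zxy) auto
    next
      case False
      then show ?thesis using D calculation(1) by (intro knuth3.xzy) auto
    qed
    ultimately show ?thesis by simp
  next
    case 1
    then have "w' = [x, z, y] @ u" by (simp add: w'_def wu len_u numeral_2_eq_2)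
    then have "[x', y', z'] = [x, z, y]" "u' = u" using wu' by auto
    moreover have "knuth3 [x, y, z] [x, z, y]"
    proof (cases "y < x")
      case True
      then show ?thesis using D calculation(1) by (intro knuth3.yxz) auto
    next
      case False
      then show ?thesis using D calculation(1) by (intro knuth3.yzx) auto
    qed
    ultimately show ?thesis by simp
  next
    case 2
    then have "w' = [z, y, x]" using len_u by (simp add: w'_def wu numeral_2_eq_2)
    then have "[x', y', z'] = [z, y, x]" using wu' by auto
    then show ?thesis using D by auto
  next
    case 3
    then have "Suc a mod n = 3" using len_u by (cases u) auto
    then have "w' ! 0 = w ! 0" "w' ! 1 = w ! 1" using 3 by (simp_all add: w'_def)
    then show ?thesis using D by (auto simp: wu wu')
  next
    case 4
    have "Suc a mod n = 0 \<or> Suc a mod n = Suc a" using a(1) by (metis Suc_lessI mod_less mod_self)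
    then have "w' ! 1 = w ! 1" "w' ! 2 = w ! 2" using 4 by (auto simp: w'_def nth_list_update)
    then show ?thesis using D by (auto simp: wu wu' numeral_2_eq_2)
  qed
  then show ?thesis
    using w a(3) w'_def wu wu' unfolding window_move_def k_def by metis
qed

text \<open>
  An exchange influences only the descent inside the exchanged pair and the two next to it.  The inner
  one changes because the exchanged elements lie in different rows, so if the descent sets are
  incomparable, one neighbour changes in the opposite direction.
\<close>

lemma knuth_move_has_type:
  assumes "knuth_move n T T'" "T \<in> tabloids n \<mu>" "sum_list \<mu> = n" "3 \<le> n"
  shows "\<exists>p\<in>{0..<int n}. knuth_move_of_type n p T T'"
proof -
  obtain i where i: "i \<in> {0..<int n}" "T' = exchange n i T"
    using assms(1) unfolding knuth_move_def by blast
  define k where "k = i + 2"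
  have ik: "i = (k - 2) mod int n" using i(1) by (simp add: k_def)
  obtain w where w: "w \<in> words \<mu>" "T = tabloid_of (length \<mu>) k w"
    using tabloid_word[OF assms(2,3)] by blast
  have n: "length w = n" using words_length[OF w(1)] assms(3) by simp
  obtain x y z u where wu: "w = [x, y, z] @ u"
  proof -
    obtain t u where "w = t @ u" "length t = 3"
      using n assms(4) by (metis append_take_drop_id length_take min.absorb2)
    then show ?thesis using length_3D that by blast
  qed
  define w' where "w' = [x, z, y] @ u"
  have T': "T' = tabloid_of (length \<mu>) k w'"
    unfolding i(2) ik w(2) wu w'_def by (rule exchange_first(2)) (use n wu in simp)
  have w': "w' \<in> words \<mu>" by (rule words_mset[OF w(1)]) (simp add: w'_def wu)
  have n': "length w' = n" using n by (simp add: w'_def wu)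
  define q where "q j = (k - 1 - int j) mod int n" for j
  have D: "q j \<in> Des n T \<longleftrightarrow> w ! (Suc j mod n) < w ! j" "q j \<in> Des n T' \<longleftrightarrow> w' ! (Suc j mod n) < w' ! j"
    if "j < n" for j
    using Des_tabloid_of[OF w(1) n[symmetric] that, of k] Des_tabloid_of[OF w' n'[symmetric] that, of k]
    by (simp_all add: q_def w(2) T')
  have q: "\<exists>j<n. r = q j" if "r \<in> Des n S" for r S
  proof -
    have "0 \<le> r" "r < int n" using that by (auto simp: Des_def)
    then show ?thesis unfolding q_def by (rule residueE) blast
  qed
  have same: "q j \<in> Des n T \<longleftrightarrow> q j \<in> Des n T'" if j: "3 \<le> j" "j < n" for j
  proof -
    have eq: "w' ! l = w ! l" if "l = 0 \<or> 3 \<le> l" for l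
      using that by (auto simp: w'_def wu nth_append nth_Cons' numeral_3_eq_3)
    have "Suc j mod n = 0 \<or> Suc j mod n = Suc j" using j(2) by (metis Suc_lessI mod_less mod_self)
    then have "w' ! (Suc j mod n) = w ! (Suc j mod n)" "w' ! j = w ! j" using j(1) eq by auto
    then show ?thesis using D[OF j(2)] by simp
  qed
  have n3: "2 < n" "1 < n" "0 < n" using assms(4) by auto
  have mid: "q 1 \<in> Des n T \<longleftrightarrow> z < y" "q 1 \<in> Des n T' \<longleftrightarrow> y < z"
    using D[of 1] n3 by (simp_all add: wu w'_def numeral_2_eq_2)
  obtain r r' where r: "r \<in> Des n T - Des n T'" "r' \<in> Des n T' - Des n T"
    using assms(1) by (auto simp: knuth_move_def)
  obtain j j' where j: "j < n" "r = q j" "j' < n" "r' = q j'" using q r by blast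
  have "j < 3" "j' < 3" using same j r by (auto simp: not_less[symmetric])
  then have j3: "j \<in> {0, 1, 2}" "j' \<in> {0, 1, 2}" by auto
  have "y \<noteq> z"
  proof
    assume "y = z"
    then have "w' = w" by (simp add: w'_def wu)
    then show False using r T' w(2) by simp
  qed
  then have "q 1 \<in> Des n T - Des n T' \<or> q 1 \<in> Des n T' - Des n T" using mid by auto
  then have "(\<exists>l\<in>{0, 2}. (q 1 \<in> Des n T - Des n T' \<and> q l \<in> Des n T' - Des n T)
      \<or> (q 1 \<in> Des n T' - Des n T \<and> q l \<in> Des n T - Des n T'))"
    using r j j3 by auto
  moreover have "(q 1 + 1) mod int n = q 0" "(q 2 + 1) mod int n = q 1"
    unfolding q_def by (subst mod_add_left_eq; simp)+
  ultimately have "\<exists>l\<in>{1, 2}. knuth_move_of_type n (q l) T T'"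
    unfolding knuth_move_of_type_def Let_def using assms(1) by auto
  moreover have "q l \<in> {0..<int n}" for l using n3 by (simp add: q_def)
  ultimately show ?thesis by blast
qed

lemma knuth_step_window_move:
  assumes "knuth_step w w'" "w \<in> words \<mu>"
  shows "\<exists>k'. window_move \<mu> k' (tabloid_of (length \<mu>) k w) (tabloid_of (length \<mu>) k w')"
proof -
  obtain p t t' q where s: "knuth3 t t'" "w = p @ t @ q" "w' = p @ t' @ q"
    using assms(1) by (auto simp: knuth_step_def)
  have rot: "tabloid_of d k (p @ v @ q) = tabloid_of d (k - int (length p)) (v @ q @ p)" for v d
    using tabloid_of_rotate[of d k "length p" "p @ v @ q"] by (simp add: rotate_append)
  have "t @ q @ p \<in> words \<mu>" by (rule words_mset[OF assms(2)]) (simp add: s)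
  then show ?thesis unfolding window_move_def s(2,3) rot using s(1) by blast
qed

abbreviation knuth_connected :: "nat list \<Rightarrow> int set list \<Rightarrow> int set list \<Rightarrow> bool" where
  "knuth_connected \<mu> \<equiv> (\<lambda>S S'. \<exists>k. window_move \<mu> k S S')\<^sup>*\<^sup>*"

lemma knuth_connected_sym: "knuth_connected \<mu> S S' \<Longrightarrow> knuth_connected \<mu> S' S"
proof (induction rule: rtranclp_induct)
  case (step y z)
  then have "\<exists>k. window_move \<mu> k z y" using window_move_sym by blast
  then show ?case using step.IH by (rule converse_rtranclp_into_rtranclp)
qed simp

lemma row_steps_connected:
  assumes "row_steps m w w'" "w \<in> words \<mu>"
  shows "\<exists>k'. knuth_connected \<mu> (tabloid_of (length \<mu>) k w) (tabloid_of (length \<mu>) k' w')"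
  using assms(1)
proof (induction rule: rtranclp_induct)
  case (step v v')
  then obtain k' where k': "knuth_connected \<mu> (tabloid_of (length \<mu>) k w) (tabloid_of (length \<mu>) k' v)" by blast
  have v: "v \<in> words \<mu>" using words_mset[OF assms(2) row_steps_mset[OF step.hyps(1)]] .
  from step.hyps(2) show ?case unfolding row_step_def
  proof (elim disjE exE conjE)
    assume "knuth_step v v'"
    then have "\<exists>l. window_move \<mu> l (tabloid_of (length \<mu>) k' v) (tabloid_of (length \<mu>) k' v')"
      using knuth_step_window_move v by blast
    with k' have "knuth_connected \<mu> (tabloid_of (length \<mu>) k w) (tabloid_of (length \<mu>) k' v')"
      by (rule rtranclp.rtrancl_into_rtrancl)
    then show ?thesis by blast
  next
    fix x u assume "v = x # u" "v' = u @ [x]"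
    then show ?thesis using k' by (auto simp: tabloid_of_rotate1)
  qed
qed blast

lemma RRSS_connected:
  assumes "T \<in> tabloids n \<mu>" "sum_list \<mu> = n"
  shows "\<exists>k. knuth_connected \<mu> (RRSS n \<mu> k) T"
proof -
  obtain w where w: "w \<in> words \<mu>" "T = tabloid_of (length \<mu>) 0 w"
    using tabloid_word[OF assms] by blast
  obtain w' where w': "row_steps 0 w w'" "sorted w'" using row_steps_sorted by blast
  have "w' = row_word \<mu>"
    using sorted_words[OF words_mset[OF w(1) row_steps_mset[OF w'(1)]] w'(2)] .
  then show ?thesis using row_steps_connected[OF w'(1) w(1), of 0] w(2) RRSS_row_word[of \<mu>] assms(2)
    by (metis knuth_connected_sym)
qed

lemma RRSS_mod: "sum_list \<mu> = n \<Longrightarrow> k mod int n = k' mod int n \<Longrightarrow> RRSS n \<mu> k = RRSS n \<mu> k'"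
  using RRSS_row_word[of \<mu>] tabloid_of_shift[of k "row_word \<mu>" k'] by simp

text \<open>
  There is no window of three letters, hence no move, and connectivity leaves nothing but \<open>RRSS\<close>.
\<close>

lemma tabloids_small:
  assumes "T \<in> tabloids n \<mu>" "sum_list \<mu> = n" "n < 3"
  shows "\<exists>k. T = RRSS n \<mu> k"
proof -
  obtain k where k: "knuth_connected \<mu> (RRSS n \<mu> k) T" using RRSS_connected[OF assms(1,2)] by blast
  from k have "T = RRSS n \<mu> k"
  proof (cases rule: rtranclp.cases)
    case (rtrancl_into_rtrancl b)
    then show ?thesis using window_move_large assms(2,3) by fastforce
  qed simp
  then show ?thesis by blast
qed

lemma tabloids_0:
  assumes "T \<in> tabloids 0 \<mu>" "S \<in> tabloids 0 \<mu>" "sum_list \<mu> = 0" shows "T = S"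
proof -
  have R: "RRSS 0 \<mu> k = RRSS 0 \<mu> 0" for k
    using RRSS_row_word[of \<mu>] assms(3) by (simp add: tabloid_of_def rows_of_def)
  have "S = RRSS 0 \<mu> 0" if "S \<in> tabloids 0 \<mu>" for S
    using tabloids_small[OF that assms(3)] R by auto
  then show ?thesis using assms(1,2) by blast
qed

lemma affine_evacuation_maps:
  assumes "is_affine_evacuation n \<mu> e" "T \<in> tabloids n \<mu>"
  shows "e T \<in> tabloids n \<mu>"
proof -
  have "bij_betw e (tabloids n \<mu>) (tabloids n \<mu>)"
    using assms(1) by (simp add: is_affine_evacuation_def graph_automorphism_def)
  then show ?thesis using assms(2) by (rule bij_betw_apply)
qed

lemma affine_evacuation_unique:
  assumes "is_affine_evacuation n \<mu> e" "is_affine_evacuation n \<mu> e'" "sum_list \<mu> = n" "T \<in> tabloids n \<mu>"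
  shows "e T = e' T"
proof (cases "n = 0")
  case True
  have "e T \<in> tabloids n \<mu>" "e' T \<in> tabloids n \<mu>"
    using affine_evacuation_maps assms(1,2,4) by blast+
  then show ?thesis using tabloids_0 True assms(3) by blast
next
  case False
  have typed: "knuth_move_of_type n ((int n - p - 1) mod int n) (f S) (f S')"
    if "is_affine_evacuation n \<mu> f" "p \<in> {0..<int n}" "S \<in> tabloids n \<mu>" "S' \<in> tabloids n \<mu>" "knuth_move_of_type n p S S'"
    for f p S S'
    using that unfolding is_affine_evacuation_def by blast
  obtain k where k: "knuth_connected \<mu> (RRSS n \<mu> k) T" using RRSS_connected[OF assms(4,3)] by blast
  from k show ?thesis
  proof (induction rule: rtranclp_induct)
    case base
    have "k mod int n \<in> {0..<int n}" using False by simp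
    then have R: "f (RRSS n \<mu> (k mod int n)) = RRSS n \<mu> ((int n - k mod int n) mod int n)"
      if "is_affine_evacuation n \<mu> f" for f
      using that unfolding is_affine_evacuation_def by blast
    show ?case using R[OF assms(1)] R[OF assms(2)] RRSS_mod[OF assms(3), of "k mod int n" k] by simp
  next
    case (step S S')
    then obtain k where win: "window_move \<mu> k S S'" by blast
    have S: "S \<in> tabloids n \<mu>" "S' \<in> tabloids n \<mu>" and n: "3 \<le> n"
      using window_move_tabloids[OF win] window_move_large[OF win] assms(3) by auto
    define p where "p = (k - 2) mod int n"
    define p' where "p' = (int n - p - 1) mod int n"
    have p: "p \<in> {0..<int n}" "p' \<in> {0..<int n}" using n by (simp_all add: p_def p'_def)
    have type: "knuth_move_of_type n p S S'"
      using knuth_move_of_type_if_window_move[OF win assms(3)] by (simp add: p_def)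
    have "window_move \<mu> (p' + 2) (f S) (f S')" if "is_affine_evacuation n \<mu> f" for f
      using window_move_if_knuth_move_of_type[OF typed[OF that p(1) S type, folded p'_def]
        affine_evacuation_maps[OF that S(1)] assms(3) n p(2)] .
    then show ?case using assms(1,2) step.IH window_move_unique by metis
  qed
qed

section \<open>Reverse-complement and R-matrix in terms of words\<close>

lemma complement_tabloid_of:
  assumes "set w \<subseteq> {..<d}" "length w = n"
  shows "complement_entries n (rev (tabloid_of d k w)) = tabloid_of d (- k) (rev (map (\<lambda>r. d - 1 - r) w))"
proof (rule nth_equalityI)
  fix r assume "r < length (complement_entries n (rev (tabloid_of d k w)))"
  then have r: "r < d" by (simp add: complement_entries_def tabloid_of_def)
  let ?v = "rev (map (\<lambda>r. d - 1 - r) w)" and ?c = "\<lambda>i. (int n + 1 - i) mod int n"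
  have flip: "letter (- k) ?v (?c i) = d - 1 - letter k w i" if i: "0 \<le> i" "i < int n" for i
  proof -
    obtain j where j: "j < n" "i = (k - int j) mod int n" using residueE[OF i] .
    have "int n + 1 - (k - int j) = (- k - int (n - 1 - j)) + 2 * int n" using j(1) by auto
    then have "?c i = (- k - int (n - 1 - j)) mod int n"
      unfolding j(2) by (metis mod_diff_right_eq mod_mult_self1)
    then have "letter (- k) ?v (?c i) = ?v ! (n - 1 - j)"
      using letter_nth_mod[of "n - 1 - j" ?v "- k"] j(1) assms(2) by simp
    also have "\<dots> = d - 1 - w ! j" using j(1) assms(2) by (simp add: rev_nth)
    also have "w ! j = letter k w i" using letter_nth_mod[of j w k] j assms(2) by simp
    finally show ?thesis .
  qed
  have invol: "?c (?c i) = i" if "0 \<le> i" "i < int n" for i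
  proof -
    have "?c (?c i) = (int n + 1 - (int n + 1 - i)) mod int n" by (rule mod_diff_right_eq)
    then show ?thesis using that by simp
  qed
  have range: "0 \<le> ?c i" "?c i < int n" if "0 \<le> i" "i < int n" for i using that by simp_all
  have less: "letter k w i < d" if "0 \<le> i" "i < int n" for i
    using letter_in_set[of w k i] assms that by (cases "w = []") auto
  have "?c ` {i \<in> {0..<int n}. letter k w i = d - 1 - r} = {i \<in> {0..<int n}. letter (- k) ?v i = r}" (is "?L = ?R")
  proof
    show "?L \<subseteq> ?R" using flip range r by auto
    show "?R \<subseteq> ?L"
    proof
      fix i assume i: "i \<in> ?R"
      then have i': "0 \<le> i" "i < int n" by auto
      have "r = d - 1 - letter k w (?c i)" using flip[OF range[OF i']] invol[OF i'] i by simp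
      then have "letter k w (?c i) = d - 1 - r" using less[OF range[OF i']] r by simp
      then have "?c i \<in> {i \<in> {0..<int n}. letter k w i = d - 1 - r}" using range[OF i'] by simp
      then show "i \<in> ?L" using invol[OF i'] by (metis (no_types, lifting) image_eqI)
    qed
  qed
  moreover have "d - Suc r < d" using r by simp
  ultimately show "complement_entries n (rev (tabloid_of d k w)) ! r = tabloid_of d (- k) ?v ! r"
    using r assms(2) by (simp add: complement_entries_def tabloid_of_def rev_nth)
qed (simp add: complement_entries_def tabloid_of_def)

text \<open>
  The representatives in \<open>{1..n}\<close> of the positions \<open>0 - j\<close>, in the order of the letters of a word cut
  at \<open>0\<close>.
\<close>

definition positions :: "nat \<Rightarrow> int list" where
  "positions n = map (\<lambda>j. int n - int j) [0..<n]"

definition tensor_of :: "nat \<Rightarrow> nat list \<Rightarrow> int multiset list" where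
  "tensor_of d w = map (entries (positions (length w)) w) [0..<d]"

lemma length_positions [simp]: "length (positions n) = n"
  by (simp add: positions_def)

lemma distinct_positions: "distinct (positions n)"
  by (auto simp: positions_def distinct_map intro: inj_onI)

lemma sorted_rev_positions: "sorted (rev (positions n))"
  by (auto simp: positions_def sorted_iff_nth_mono rev_nth)

lemma entries_eq_filter: "length xs = length w \<Longrightarrow>
    set (map fst (filter (\<lambda>p. snd p = r) (zip xs w))) = {xs ! j | j. j < length w \<and> w ! j = r}"
  by (force simp: set_zip)

lemma distinct_entries:
  "distinct xs \<Longrightarrow> distinct (map fst (filter P (zip xs w)))"
proof (induction xs arbitrary: w)
  case (Cons x xs)
  then show ?case by (cases w) (auto dest: set_zip_leftD)
qed simp

lemma entries_positions:
  "entries (positions (length w)) w r = mset_set {int (length w) - int j | j. j < length w \<and> w ! j = r}"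
proof -
  have "{int (length w) - int j | j. j < length w \<and> w ! j = r} =
      set (map fst (filter (\<lambda>p. snd p = r) (zip (positions (length w)) w)))"
    by (subst entries_eq_filter) (auto intro!: Collect_cong ex_cong1 simp: positions_def)
  then show ?thesis
    by (simp only: mset_set_set distinct_entries distinct_positions entries_def)
qed

lemma tabloid_row_positions:
  "{i \<in> {0..<int (length w)}. letter 0 w i = r} =
    {(int (length w) - int j) mod int (length w) | j. j < length w \<and> w ! j = r}"
proof -
  have eq: "(int (length w) - int j) mod int (length w) = (0 - int j) mod int (length w)" for j by simp
  show ?thesis unfolding eq
  proof (intro equalityI subsetI)
    fix i assume i: "i \<in> {i \<in> {0..<int (length w)}. letter 0 w i = r}"
    then have "0 \<le> i" "i < int (length w)" by auto
    then obtain j where "j < length w" "i = (0 - int j) mod int (length w)" by (rule residueE)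
    then show "i \<in> {(0 - int j) mod int (length w) |j. j < length w \<and> w ! j = r}"
      using i letter_nth_mod[of j w 0] by auto
  next
    fix i assume "i \<in> {(0 - int j) mod int (length w) |j. j < length w \<and> w ! j = r}"
    then obtain j where j: "j < length w" "w ! j = r" "i = (0 - int j) mod int (length w)" by blast
    then show "i \<in> {i \<in> {0..<int (length w)}. letter 0 w i = r}"
      using letter_nth_mod[OF j(1), of 0] residue_bounds[OF j(1), of "0 - int j"] by simp
  qed
qed

lemma image_Collect_eq: "(\<And>j. P j \<Longrightarrow> f (g j) = h j) \<Longrightarrow> f ` {g j | j. P j} = {h j | j. P j}"
  by force

lemma tensor_of_tabloid: "tabloid_to_tensor (length w) (tabloid_of d 0 w) = tensor_of d w"
proof -
  let ?n = "length w"
  have rep: "((int ?n - int j) mod int ?n - 1) mod int ?n + 1 = int ?n - int j" if "j < ?n" for j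
  proof -
    have "((int ?n - int j) mod int ?n - 1) mod int ?n = (int ?n - int j - 1) mod int ?n"
      by (rule mod_diff_left_eq)
    then show ?thesis using that by simp
  qed
  have "(\<lambda>x. (x - 1) mod int ?n + 1) ` {i \<in> {0..<int ?n}. letter 0 w i = r} =
      {int ?n - int j | j. j < ?n \<and> w ! j = r}" for r
    unfolding tabloid_row_positions by (rule image_Collect_eq) (use rep in blast)
  then show ?thesis
    unfolding tabloid_to_tensor_def tensor_of_def tabloid_of_def rows_of_def by (simp add: entries_positions)
qed

lemma tabloid_of_tensor: "tensor_to_tabloid (length w) (tensor_of d w) = tabloid_of d 0 w"
proof -
  let ?n = "length w"
  have fin: "finite {int ?n - int j | j. j < ?n \<and> w ! j = r}" for r by simp
  have "(\<lambda>x. x mod int ?n) ` set_mset (entries (positions ?n) w r) = {i \<in> {0..<int ?n}. letter 0 w i = r}" for r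
    unfolding tabloid_row_positions entries_positions finite_set_mset_mset_set[OF fin]
    by (rule image_Collect_eq) (rule refl)
  then show ?thesis
    unfolding tensor_to_tabloid_def tensor_of_def tabloid_of_def rows_of_def by simp
qed

lemma paren_word_entries:
  assumes "distinct xs" "sorted (rev xs)"
  shows "paren_word (entries xs w (Suc a)) (entries xs w a) = parens a xs w"
proof -
  let ?P = "\<lambda>p. snd p \<in> {a, Suc a}"
  define L where "L = filter ?P (zip xs w)"
  have dist: "distinct (map fst L)" unfolding L_def by (rule distinct_entries[OF assms(1)])
  have cnt: "count (entries xs w r) x = (if (x, r) \<in> set (zip xs w) then 1 else 0)" for r x
  proof -
    have d: "distinct (map fst (filter (\<lambda>p. snd p = r) (zip xs w)))" by (rule distinct_entries[OF assms(1)])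
    have m: "x \<in> set (map fst (filter (\<lambda>p. snd p = r) (zip xs w))) \<longleftrightarrow> (x, r) \<in> set (zip xs w)" by force
    show ?thesis using d m unfolding entries_def by (metis distinct_count_atmost_1)
  qed
  have sorted: "sorted (rev (map fst L))"
  proof -
    have "sorted (rev (map fst (filter P (zip xs w))))" for P
      using assms(2)
    proof (induction xs arbitrary: w)
      case (Cons x xs)
      then show ?case by (cases w) (auto simp: sorted_append dest: set_zip_leftD)
    qed simp
    then show ?thesis by (simp add: L_def)
  qed
  have "set_mset (entries xs w (Suc a) + entries xs w a) = set (rev (map fst L))"
    by (force simp: L_def entries_def)
  then have keys: "sorted_list_of_set (set_mset (entries xs w (Suc a) + entries xs w a)) = rev (map fst L)"
    using sorted dist sorted_list_of_set.idem_if_sorted_distinct[of "rev (map fst L)"] by simp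
  define lab where "lab = (\<lambda>(x :: int, l). (x, if l = a then LP else RP))"
  have one: "replicate (count (entries xs w (Suc a)) (fst p)) (fst p, RP) @
      replicate (count (entries xs w a) (fst p)) (fst p, LP) = [lab p]" if "p \<in> set L" for p
  proof -
    obtain x l where p: "p = (x, l)" by (cases p)
    have mem: "(x, l) \<in> set (zip xs w)" "l = a \<or> l = Suc a" using that by (auto simp: L_def p)
    have "(x, l') \<in> set (zip xs w) \<longleftrightarrow> l' = l" for l'
      using mem(1) assms(1) by (auto simp: set_zip nth_eq_iff_index_eq)
    then show ?thesis using mem(2) by (auto simp: cnt p lab_def)
  qed
  have "paren_word (entries xs w (Suc a)) (entries xs w a) =
      concat (map (\<lambda>p. replicate (count (entries xs w (Suc a)) (fst p)) (fst p, RP) @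
        replicate (count (entries xs w a) (fst p)) (fst p, LP)) (rev L))"
    unfolding paren_word_def keys by (simp add: rev_map o_def)
  also have "\<dots> = concat (map (\<lambda>p. [lab p]) (rev L))"
    by (intro arg_cong[where f = concat] map_cong refl one) simp
  also have "\<dots> = rev (map lab L)" by (simp add: rev_map)
  also have "\<dots> = parens a xs w" by (simp add: parens_def L_def lab_def)
  finally show ?thesis .
qed

lemma R_matrix_entries:
  assumes "distinct xs" "sorted (rev xs)" "length xs = length w"
  shows "R_matrix (entries xs w (Suc a), entries xs w a) =
    (entries xs (reflect a w) (Suc a), entries xs (reflect a w) a)"
  unfolding R_matrix_def
  using entries_reflection[OF reflection_reflect assms(3), of a "Suc a"]
    entries_reflection[OF reflection_reflect assms(3), of a a]
  by (simp add: paren_word_entries[OF assms(1,2)] reflect_parens_def Let_def)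

lemma R_simple_tensor_of:
  assumes "i \<in> {1..<d}"
  shows "R_simple i (tensor_of d w) = tensor_of d (reflect (i - 1) w)"
proof -
  obtain a where a: "i = Suc a" using assms by (cases i) auto
  let ?xs = "positions (length w)"
  have other: "entries ?xs w r = entries ?xs (reflect a w) r" if "r \<noteq> a" "r \<noteq> Suc a" for r
    using entries_other[OF reflection_reflect that] .
  show ?thesis
    using assms R_matrix_entries[OF distinct_positions sorted_rev_positions length_positions, of w a]
    by (intro nth_equalityI) (auto simp: R_simple_def tensor_of_def a nth_list_update other)
qed

section \<open>Chains of reflections\<close>

definition reflects :: "nat list \<Rightarrow> nat list \<Rightarrow> nat list" where
  "reflects ws w = fold (\<lambda>i. reflect (i - 1)) ws w"

lemma reflects_simps [simp]: "reflects [] w = w" "reflects (i # ws) w = reflects ws (reflect (i - 1) w)"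
  by (simp_all add: reflects_def)

lemma fold_R_simple: "set ws \<subseteq> {1..<d} \<Longrightarrow> fold R_simple ws (tensor_of d w) = tensor_of d (reflects ws w)"
  by (induction ws arbitrary: w) (simp_all add: R_simple_tensor_of)

lemma length_reflects [simp]: "length (reflects ws w) = length w"
  by (induction ws arbitrary: w) simp_all

lemma reflects_rotate: "reflects ws (rotate m w) = rotate m (reflects ws w)"
  by (induction ws arbitrary: w) (simp_all add: reflect_rotate)

lemma reflects_inject: "reflects ws w = reflects ws w' \<Longrightarrow> w = w'"
proof (induction ws arbitrary: w w')
  case (Cons i ws)
  then have "reflect (i - 1) w = reflect (i - 1) w'" by simp
  then show ?case by (metis reflect_reflect)
qed simp

lemma rotate_front: "Suc i < length w \<Longrightarrow> \<exists>u. rotate i w = w ! i # w ! Suc i # u"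
proof -
  assume i: "Suc i < length w"
  then have "drop i w = w ! i # w ! Suc i # drop (Suc (Suc i)) w"
    by (simp add: Cons_nth_drop_Suc)
  then show ?thesis using i by (simp add: rotate_drop_take)
qed

lemma sorted_reflect: "sorted w \<Longrightarrow> sorted (reflect a w)"
  unfolding sorted_iff_nth_Suc
proof (intro allI impI)
  fix i assume s: "\<forall>i. Suc i < length w \<longrightarrow> w ! i \<le> w ! Suc i" and i: "Suc i < length (reflect a w)"
  obtain u where u: "rotate i w = w ! i # w ! Suc i # u" using rotate_front[of i w] i by auto
  obtain v where v: "rotate i (reflect a w) = reflect a w ! i # reflect a w ! Suc i # v"
    using rotate_front[OF i] by blast
  have "reflect a (w ! i # w ! Suc i # u) = reflect a w ! i # reflect a w ! Suc i # v"
    using reflect_rotate[of a i w] u v by simp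
  from descent_reflect[OF this] show "reflect a w ! i \<le> reflect a w ! Suc i" using s i by (simp add: not_less[symmetric])
qed

lemma sorted_reflects: "sorted w \<Longrightarrow> sorted (reflects ws w)"
  by (induction ws arbitrary: w) (simp_all add: sorted_reflect)

lemma mset_reflects:
  "set ws \<subseteq> {1..} \<Longrightarrow> mset (reflects ws w) = image_mset (fold (\<lambda>i. transpose (i - 1) i) ws) (mset w)"
proof (induction ws arbitrary: w)
  case (Cons i ws)
  then have "Suc (i - 1) = i" by simp
  then have "mset (reflect (i - 1) w) = image_mset (transpose (i - 1) i) (mset w)"
    using mset_reflect[of "i - 1" w] by simp
  then show ?case using Cons by (simp add: image_mset.compositionality o_def)
qed simp

text \<open>
  The reflections along \<open>ws\<close> permute the letters by the inverse of \<open>simple_product ws\<close>; rows are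
  numbered from \<open>1\<close> there and from \<open>0\<close> in words.
\<close>

lemma simple_product_fold:
  "set ws \<subseteq> {1..} \<Longrightarrow> simple_product ws (Suc (fold (\<lambda>i. transpose (i - 1) i) ws r)) = Suc r"
proof (induction ws arbitrary: r)
  case Nil
  then show ?case by (simp add: simple_product_def)
next
  case (Cons i ws)
  have "simple_product (i # ws) = transpose i (i + 1) \<circ> simple_product ws" by (simp add: simple_product_def)
  moreover have "transpose i (i + 1) (Suc (transpose (i - 1) i r)) = Suc r"
    using Cons.prems by (auto simp: transpose_def)
  ultimately show ?case using Cons by simp
qed

section \<open>Reflections and Knuth relations\<close>

text \<open>
  A foreign letter does not influence the reflection, so it may be inserted on either side of its
  neighbour.
\<close>

lemma reflect_swap:
  assumes "\<not> {x, y} \<subseteq> {a, Suc a}"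
  shows "\<exists>p' x' y' q'. length p' = length p \<and> reflect a (p @ [x, y] @ q) = p' @ [x', y'] @ q'
     \<and> reflect a (p @ [y, x] @ q) = p' @ [y', x'] @ q'"
proof -
  have other: "\<exists>p' x' q'. length p' = length p \<and> reflect a (p @ [x, c] @ q) = p' @ [x', c] @ q'
     \<and> reflect a (p @ [c, x] @ q) = p' @ [c, x'] @ q'" if c: "c \<noteq> a" "c \<noteq> Suc a" for x c
  proof -
    have "length (reflect a (p @ x # q)) = length p + length (x # q)" by simp
    then obtain p' r where r: "reflect a (p @ x # q) = p' @ r" "length p' = length p" "length r = length (x # q)"
      using split_length by blast
    then obtain x' q' where x': "r = x' # q'" by (auto simp: length_Suc_conv)
    have ref: "reflection a (p @ x # q) (p' @ x' # q')" using reflection_reflect[of a "p @ x # q"] r x' by simp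
    have "reflection a (p @ [c] @ (x # q)) (p' @ [c] @ (x' # q'))"
      using ref r(2) c by (intro reflection.other) simp_all
    moreover have "reflection a ((p @ [x]) @ [c] @ q) ((p' @ [x']) @ [c] @ q')"
      using ref r(2) c by (intro reflection.other) simp_all
    ultimately show ?thesis using r(2) unfolding reflection_iff
      by (intro exI[of _ p'] exI[of _ x'] exI[of _ q']) auto
  qed
  show ?thesis
  proof (cases "x \<in> {a, Suc a}")
    case True
    then show ?thesis using assms other[of y x] by blast
  next
    case False
    then show ?thesis using assms other[of x y] by blast
  qed
qed

text \<open>
  A matched pair does not influence the letter in front of it.
\<close>

lemma reflect_matched_second:
  assumes "reflect a (x # u) = x' # u'"
  shows "reflect a (x # Suc a # a # u) = x' # Suc a # a # u'"
proof -
  have "reflection a ([x] @ u) ([x'] @ u')" using reflection_reflect[of a "x # u"] assms by simp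
  then have "reflection a ([x] @ [Suc a, a] @ u) ([x'] @ [Suc a, a] @ u')" by (rule reflection.matched) simp
  then show ?thesis by (simp add: reflection_iff)
qed

lemma reflect_Cons: "\<exists>x' u'. reflect a (x # u) = x' # u' \<and> (x \<in> {a, Suc a} \<longrightarrow> x' \<in> {a, Suc a})"
proof -
  obtain x' u' where xu: "reflect a (x # u) = x' # u'" using length_reflect[of a "x # u"] by (metis length_Suc_conv length_Cons)
  have "list_all2 (\<lambda>x y. x = y \<or> {x, y} \<subseteq> {a, Suc a}) (x # u) (x' # u')"
    using reflection_letters[OF reflection_reflect, of a "x # u"] xu by simp
  then show ?thesis using xu by auto
qed

lemma descent_second:
  assumes "reflect a (w @ x # y # u) = w' @ x' # y' # u'" "length w' = length w"
  shows "y' < x' \<longleftrightarrow> y < x"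
proof -
  have "reflect a (x # y # u @ w) = x' # y' # u' @ w'"
    using reflect_rotate[of a "length w" "w @ x # y # u"] assms rotate_append[of w "x # y # u"]
      rotate_append[of w' "x' # y' # u'"] by simp
  then show ?thesis by (rule descent_reflect)
qed

text \<open>
  If the exchanged letters are \<open>a\<close> and \<open>a + 1\<close>, then the third letter is one of them as well, the window
  consists of a matched pair and a further letter, and both words keep the pair and change the further
  letter in the same way.  Otherwise one of the exchanged letters is foreign, the same letters are
  exchanged after the reflection, and preservation of descents shows that this is again a Knuth
  relation.
\<close>

lemma reflect_window:
  assumes "knuth3 t t'"
  shows "\<exists>s s' v. reflect a (t @ u) = s @ v \<and> reflect a (t' @ u) = s' @ v \<and> knuth3 s s'"
proof -
  have A: "\<exists>s s' v. reflect a ([y, x, z] @ u) = s @ v \<and> reflect a ([y, z, x] @ u) = s' @ v \<and> knuth3 s s'"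
    if "x < y" "y \<le> z" for x y z
  proof (cases "{x, z} \<subseteq> {a, Suc a}")
    case True
    then have eq: "x = a" "y = Suc a" "z = Suc a" using that by auto
    obtain c u' where c: "reflect a (Suc a # u) = c # u'" "c \<in> {a, Suc a}" using reflect_Cons[of a "Suc a" u] by auto
    have "reflect a ([y, x, z] @ u) = [Suc a, a, c] @ u'" "reflect a ([y, z, x] @ u) = [c, Suc a, a] @ u'"
      using c(1) reflect_matched_second[OF c(1)] by (simp_all add: eq reflect_matched)
    moreover have "knuth3 [Suc a, a, c] [c, Suc a, a]"
      using c(2) knuth3.yxz[of a "Suc a" "Suc a"] knuth3.zxy[of a a "Suc a"] by auto
    ultimately show ?thesis by blast
  next
    case False
    obtain p' x' z' q' where s: "length p' = length [y]" "reflect a ([y] @ [x, z] @ u) = p' @ [x', z'] @ q'"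
        "reflect a ([y] @ [z, x] @ u) = p' @ [z', x'] @ q'"
      using reflect_swap[OF False, of "[y]" u] by blast
    then obtain y' where p': "p' = [y']" by (auto simp: length_Suc_conv)
    have r: "reflect a ([y, x, z] @ u) = [y', x', z'] @ q'" "reflect a ([y, z, x] @ u) = [y', z', x'] @ q'"
      using s p' by simp_all
    have "x' < y' \<longleftrightarrow> x < y" "z' < y' \<longleftrightarrow> z < y"
      using descent_reflect[of a y x "z # u" y' x' "z' # q'"] descent_reflect[of a y z "x # u" y' z' "x' # q'"] r by simp_all
    then have "knuth3 [y', x', z'] [y', z', x']" using that by (intro knuth3.yxz) auto
    then show ?thesis using r by blast
  qed
  have B: "\<exists>s s' v. reflect a ([x, z, y] @ u) = s @ v \<and> reflect a ([z, x, y] @ u) = s' @ v \<and> knuth3 s s'"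
    if "x \<le> y" "y < z" for x y z
  proof (cases "{x, z} \<subseteq> {a, Suc a}")
    case True
    then have eq: "x = a" "y = a" "z = Suc a" using that by auto
    obtain c u' where c: "reflect a (a # u) = c # u'" "c \<in> {a, Suc a}" using reflect_Cons[of a a u] by auto
    have "reflect a ([x, z, y] @ u) = [c, Suc a, a] @ u'" "reflect a ([z, x, y] @ u) = [Suc a, a, c] @ u'"
      using c(1) reflect_matched_second[OF c(1)] by (simp_all add: eq reflect_matched)
    moreover have "knuth3 [c, Suc a, a] [Suc a, a, c]"
      using c(2) knuth3.yzx[of a "Suc a" "Suc a"] knuth3.xzy[of a a "Suc a"] by auto
    ultimately show ?thesis by blast
  next
    case False
    obtain x' z' y' q' where r: "reflect a ([x, z, y] @ u) = [x', z', y'] @ q'" "reflect a ([z, x, y] @ u) = [z', x', y'] @ q'"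
    proof -
      obtain p' x' z' q' where s: "length p' = length ([] :: nat list)" "reflect a ([] @ [x, z] @ y # u) = p' @ [x', z'] @ q'"
          "reflect a ([] @ [z, x] @ y # u) = p' @ [z', x'] @ q'"
        using reflect_swap[OF False, of "[]" "y # u"] by blast
      have "length q' = Suc (length u)" using arg_cong[OF s(2), of length] s(1) by simp
      then obtain y' q'' where "q' = y' # q''" by (auto simp: length_Suc_conv)
      then show ?thesis using s that by simp
    qed
    have "y' < z' \<longleftrightarrow> y < z" "y' < x' \<longleftrightarrow> y < x"
      using descent_second[of a "[x]" z y u "[x']" z' y' q'] descent_second[of a "[z]" x y u "[z']" x' y' q'] r by simp_all
    then have "knuth3 [x', z', y'] [z', x', y']" using that by (intro knuth3.xzy) auto
    then show ?thesis using r by blast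
  qed
  from assms show ?thesis
  proof cases
    case (yxz x y z) then show ?thesis using A by blast
  next
    case (yzx x y z) then show ?thesis using A[of x y z] knuth3_sym by blast
  next
    case (xzy x y z) then show ?thesis using B by blast
  next
    case (zxy x y z) then show ?thesis using B[of x y z] knuth3_sym by blast
  qed
qed

section \<open>Affine evacuation by reflections\<close>

lemma tabloid_of_0_eq: "tabloid_of d k [] = tabloid_of d k' []"
  by (simp add: tabloid_of_def rows_of_def)

lemma simple_product_append: "simple_product (xs @ ys) = simple_product xs \<circ> simple_product ys"
  by (induction xs) (simp_all add: simple_product_def o_assoc)

text \<open>
  This cycle is the factor by which \<open>w\<^sub>0\<close> on \<open>d + 1\<close> letters exceeds \<open>w\<^sub>0\<close> on \<open>d\<close> letters.
\<close>

lemma simple_product_cycle: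
  "simple_product [1..<Suc d] i = (if i \<in> {1..d} then Suc i else if i = Suc d then 1 else i)"
proof (induction d arbitrary: i)
  case 0
  then show ?case by (simp add: simple_product_def)
next
  case (Suc d)
  have "[1..<Suc (Suc d)] = [1..<Suc d] @ [Suc d]" by (rule upt_Suc_append) simp
  then have step: "simple_product [1..<Suc (Suc d)] i = simple_product [1..<Suc d] (transpose (Suc d) (Suc (Suc d)) i)"
    by (simp only: simple_product_append) (simp add: simple_product_def)
  show ?case unfolding step Suc.IH by (auto simp: transpose_def)
qed

lemma ex_longest_word: "\<exists>ws. set ws \<subseteq> {1..<d} \<and> simple_product ws = w\<^sub>0 d"
proof (induction d)
  case 0
  have "simple_product [] = w\<^sub>0 0" by (auto simp: simple_product_def w\<^sub>0_def)
  then show ?case by (intro exI[of _ "[]"]) simp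
next
  case (Suc d)
  then obtain js where js: "set js \<subseteq> {1..<d}" "simple_product js = w\<^sub>0 d" by blast
  have "simple_product ([1..<Suc d] @ js) = w\<^sub>0 (Suc d)"
    unfolding simple_product_append js(2) fun_eq_iff o_apply simple_product_cycle w\<^sub>0_def by auto
  moreover have "set ([1..<Suc d] @ js) \<subseteq> {1..<Suc d}" using js(1) by auto
  ultimately show ?case by blast
qed

text \<open>
  Steps (1) and (2) of the theorem for a word cut at \<open>0\<close>, followed by the reflections along \<open>ws\<close>.
\<close>

definition evacuation_word :: "nat \<Rightarrow> nat list \<Rightarrow> nat list \<Rightarrow> nat list" where
  "evacuation_word d ws w = reflects ws (rev (map (\<lambda>r. d - 1 - r) w))"

lemma evacuation_word_words:
  assumes "w \<in> words \<mu>" "set ws \<subseteq> {1..<length \<mu>}" "simple_product ws = w\<^sub>0 (length \<mu>)"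
  shows "evacuation_word (length \<mu>) ws w \<in> words \<mu>"
proof (rule words_mset[OF assms(1)])
  let ?d = "length \<mu>" and ?F = "fold (\<lambda>i. transpose (i - 1) i) ws"
  have is1: "set ws \<subseteq> {1..}" using assms(2) by auto
  have F: "?F (?d - 1 - r) = r" if "r < ?d" for r
  proof -
    have "w\<^sub>0 ?d (Suc (?F (?d - 1 - r))) = Suc (?d - 1 - r)"
      using simple_product_fold[OF is1, of "?d - 1 - r"] assms(3) by simp
    then show ?thesis using that by (auto simp: w\<^sub>0_def split: if_splits)
  qed
  have "mset (evacuation_word ?d ws w) = image_mset (\<lambda>r. ?F (?d - 1 - r)) (mset w)"
    by (simp add: evacuation_word_def mset_reflects[OF is1] image_mset.compositionality o_def)
  also have "\<dots> = image_mset (\<lambda>r. r) (mset w)"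
    by (rule image_mset_cong) (use words_set[OF assms(1)] F in auto)
  finally show "mset (evacuation_word ?d ws w) = mset w" by simp
qed

lemma length_evacuation_word [simp]: "length (evacuation_word d ws w) = length w"
  by (simp add: evacuation_word_def)

lemma evacuation_word_sorted: "sorted w \<Longrightarrow> sorted (evacuation_word d ws w)"
proof -
  assume "sorted w"
  then have "sorted (rev (map (\<lambda>r. d - 1 - r) w))"
    by (induction w) (auto simp: sorted_append)
  then show ?thesis unfolding evacuation_word_def by (rule sorted_reflects)
qed

lemma evacuation_word_inject:
  assumes "evacuation_word d ws w = evacuation_word d ws w'" "set w \<subseteq> {..<d}" "set w' \<subseteq> {..<d}"
  shows "w = w'"
proof -
  have "map (\<lambda>r. d - 1 - r) w = map (\<lambda>r. d - 1 - r) w'"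
    using reflects_inject assms(1) unfolding evacuation_word_def by blast
  moreover have "inj_on (\<lambda>r. d - 1 - r) (set w \<union> set w')"
    by (rule inj_on_subset[of _ "{..<d}"]) (use assms(2,3) in \<open>auto intro!: inj_onI\<close>)
  ultimately show ?thesis by (metis map_inj_on)
qed

lemma mset_rotate: "mset (rotate m w) = mset w"
proof (induction m)
  case (Suc m)
  have "mset (rotate1 v) = mset v" for v :: "'a list" by (cases v) simp_all
  then show ?case using Suc by simp
qed simp

lemma rotate_rev_rotate: "rotate m (rev (rotate m w)) = rev w"
proof (induction m arbitrary: w)
  case (Suc m)
  have "rotate (Suc m) (rev (rotate (Suc m) w)) = rotate1 (rotate m (rev (rotate m (rotate1 w))))"
    by (simp add: rotate1_rotate_swap)
  also have "\<dots> = rotate1 (rev (rotate1 w))" by (simp add: Suc)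
  also have "\<dots> = rev w" by (cases w) simp_all
  finally show ?case .
qed simp

text \<open>
  Reversal turns a rotation into the inverse rotation, which explains the sign of \<open>k\<close> in the next
  lemmas.
\<close>

lemma evacuation_word_rotate:
  "rotate m (evacuation_word d ws (rotate m w)) = evacuation_word d ws w"
  unfolding evacuation_word_def reflects_rotate[symmetric] rotate_map[symmetric] rotate_rev_rotate ..

lemma reflects_window:
  "knuth3 t t' \<Longrightarrow> \<exists>s s' v. reflects ws (t @ u) = s @ v \<and> reflects ws (t' @ u) = s' @ v \<and> knuth3 s s'"
proof (induction ws arbitrary: t t' u)
  case (Cons i ws)
  obtain s s' v where "reflect (i - 1) (t @ u) = s @ v" "reflect (i - 1) (t' @ u) = s' @ v" "knuth3 s s'"
    using reflect_window[OF Cons.prems] by blast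
  then show ?case using Cons.IH[of s s' v] by simp
qed auto

lemma knuth3_rev_complement:
  assumes "knuth3 t t'" "set t \<subseteq> {..<d}"
  shows "knuth3 (rev (map (\<lambda>r. d - 1 - r) t)) (rev (map (\<lambda>r. d - 1 - r) t'))"
  using assms
proof cases
  case (yxz x y z)
  then show ?thesis using assms(2) knuth3.xzy[of "d - 1 - z" "d - 1 - y" "d - 1 - x"] by auto
next
  case (yzx x y z)
  then show ?thesis using assms(2) knuth3.zxy[of "d - 1 - z" "d - 1 - y" "d - 1 - x"] by auto
next
  case (xzy x y z)
  then show ?thesis using assms(2) knuth3.yxz[of "d - 1 - z" "d - 1 - y" "d - 1 - x"] by auto
next
  case (zxy x y z)
  then show ?thesis using assms(2) knuth3.yzx[of "d - 1 - z" "d - 1 - y" "d - 1 - x"] by auto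
qed

definition evacuation :: "nat list \<Rightarrow> nat list \<Rightarrow> int set list \<Rightarrow> int set list" where
  "evacuation \<mu> ws = restrict (\<lambda>T. tabloid_of (length \<mu>) 0 (evacuation_word (length \<mu>) ws
     (THE w. w \<in> words \<mu> \<and> T = tabloid_of (length \<mu>) 0 w))) (tabloids (sum_list \<mu>) \<mu>)"

lemma evacuation_tabloid_of:
  assumes "w \<in> words \<mu>"
  shows "evacuation \<mu> ws (tabloid_of (length \<mu>) k w) = tabloid_of (length \<mu>) (- k) (evacuation_word (length \<mu>) ws w)"
proof -
  let ?d = "length \<mu>" and ?n = "int (length w)"
  have zero: "evacuation \<mu> ws (tabloid_of ?d 0 v) = tabloid_of ?d 0 (evacuation_word ?d ws v)" if v: "v \<in> words \<mu>" for v
  proof -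
    have "(THE w. w \<in> words \<mu> \<and> tabloid_of ?d 0 v = tabloid_of ?d 0 w) = v"
    proof (rule the_equality)
      fix w assume w: "w \<in> words \<mu> \<and> tabloid_of ?d 0 v = tabloid_of ?d 0 w"
      then show "w = v"
        using tabloid_of_inject[of ?d 0 v w] words_length[of v \<mu>] words_length[of w \<mu>] words_set[OF v] v by simp
    qed (use v in simp)
    then show ?thesis using tabloid_of_in_tabloids[OF v, of 0] by (simp add: evacuation_def)
  qed
  show ?thesis
  proof (cases "w = []")
    case True
    then show ?thesis using zero[OF assms] tabloid_of_0_eq
      by (metis length_0_conv length_evacuation_word)
  next
    case False
    \<comment> \<open>Rotate until the cut ws at \<open>0\<close>, apply the definition, and rotate back in the opposite sense.\<close>
    define m where "m = nat (k mod ?n)"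
    have m: "int m = k mod ?n" using False by (simp add: m_def)
    have rw: "rotate m w \<in> words \<mu>" by (rule words_mset[OF assms mset_rotate])
    have "tabloid_of ?d k w = tabloid_of ?d (k - int m) (rotate m w)" by (simp add: tabloid_of_rotate)
    also have "\<dots> = tabloid_of ?d 0 (rotate m w)"
      by (rule tabloid_of_shift) (simp add: m mod_diff_right_eq)
    finally have "evacuation \<mu> ws (tabloid_of ?d k w) = tabloid_of ?d 0 (evacuation_word ?d ws (rotate m w))"
      using zero[OF rw] by simp
    also have "\<dots> = tabloid_of ?d (0 - int m) (evacuation_word ?d ws w)"
      using tabloid_of_rotate[of ?d 0 m "evacuation_word ?d ws (rotate m w)"] by (simp add: evacuation_word_rotate)
    also have "\<dots> = tabloid_of ?d (- k) (evacuation_word ?d ws w)"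
      by (rule tabloid_of_shift) (simp add: m mod_minus_eq)
    finally show ?thesis .
  qed
qed

lemma evacuation_window_move:
  assumes "window_move \<mu> k T T'" "set ws \<subseteq> {1..<length \<mu>}" "simple_product ws = w\<^sub>0 (length \<mu>)"
    and "sum_list \<mu> = n"
  shows "window_move \<mu> (3 - int n - k) (evacuation \<mu> ws T) (evacuation \<mu> ws T')"
proof -
  let ?d = "length \<mu>" and ?E = "evacuation_word (length \<mu>) ws" and ?c = "\<lambda>r. length \<mu> - 1 - r"
  obtain t t' u where 1: "t @ u \<in> words \<mu>" "knuth3 t t'" "T = tabloid_of ?d k (t @ u)" "T' = tabloid_of ?d k (t' @ u)"
    using assms(1) by (auto simp: window_move_def)
  have len: "length t = 3" "length t' = 3" "length (t @ u) = n"
    using knuth3_length[OF 1(2)] words_length[OF 1(1)] assms(4) by auto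
  have "set t \<subseteq> {..<?d}" using words_set[OF 1(1)] by simp
  from knuth3_rev_complement[OF 1(2) this]
  obtain s s' v where s: "reflects ws (rev (map ?c t) @ rev (map ?c u)) = s @ v"
      "reflects ws (rev (map ?c t') @ rev (map ?c u)) = s' @ v" "knuth3 s s'"
    using reflects_window by blast
  have rot: "rotate (length u) (?E (r @ u)) = reflects ws (rev (map ?c r) @ rev (map ?c u))" for r
    using rotate_append[of "rev (map ?c u)" "rev (map ?c r)"]
    by (simp add: evacuation_word_def flip: reflects_rotate)
  \<comment> \<open>Reversal puts the window at the end of the word.  Rotating the other \<open>n - 3\<close> letters behind it
    moves the cut from \<open>- k\<close> to \<open>3 - n - k\<close>.\<close>
  have ev: "evacuation \<mu> ws (tabloid_of ?d k (r @ u)) = tabloid_of ?d (3 - int n - k) (reflects ws (rev (map ?c r) @ rev (map ?c u)))"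
    if "r @ u \<in> words \<mu>" for r
  proof -
    have "evacuation \<mu> ws (tabloid_of ?d k (r @ u)) = tabloid_of ?d (- k) (?E (r @ u))"
      by (rule evacuation_tabloid_of[OF that])
    also have "\<dots> = tabloid_of ?d (- k - int (length u)) (rotate (length u) (?E (r @ u)))"
      by (simp add: tabloid_of_rotate)
    also have "- k - int (length u) = 3 - int n - k" using len by simp
    finally show ?thesis by (simp add: rot)
  qed
  have w': "t' @ u \<in> words \<mu>" using words_knuth3 1 by blast
  have "rotate (length u) (?E (t @ u)) \<in> words \<mu>"
    by (rule words_mset[OF evacuation_word_words[OF 1(1) assms(2,3)] mset_rotate])
  then have "s @ v \<in> words \<mu>" unfolding rot s(1) .
  moreover have "evacuation \<mu> ws T = tabloid_of ?d (3 - int n - k) (s @ v)"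
      "evacuation \<mu> ws T' = tabloid_of ?d (3 - int n - k) (s' @ v)"
    unfolding 1(3,4) ev[OF 1(1)] ev[OF w'] s by (rule refl)+
  ultimately show ?thesis unfolding window_move_def using s(3) by blast
qed

text \<open>
  On a finite graph an injective vertex map that preserves edges also reflects them, because it permutes
  the finite set of edges.
\<close>

lemma graph_automorphismI:
  assumes "finite V" "E \<subseteq> Pow V" "e ` V \<subseteq> V" "inj_on e V"
    and "\<And>u v. u \<in> V \<Longrightarrow> v \<in> V \<Longrightarrow> {u, v} \<in> E \<Longrightarrow> {e u, e v} \<in> E"
    and "\<And>X. X \<in> E \<Longrightarrow> \<exists>u v. X = {u, v}"
  shows "graph_automorphism V E e"
proof -
  have inj: "inj_on ((`) e) (Pow V)" using assms(4) by (rule inj_on_image_Pow)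
  have fin: "finite E" using assms(1,2) by (meson finite_Pow_iff finite_subset)
  have "e ` X \<in> E" if X: "X \<in> E" for X
  proof -
    obtain u v where uv: "X = {u, v}" using assms(6)[OF X] by blast
    then have "u \<in> V" "v \<in> V" using X assms(2) by auto
    then show ?thesis using assms(5) X uv by simp
  qed
  then have "(`) e ` E \<subseteq> E" by auto
  then have surj: "(`) e ` E = E" using endo_inj_surj[OF fin] inj_on_subset[OF inj assms(2)] by blast
  have "{u, v} \<in> E" if uv: "u \<in> V" "v \<in> V" "{e u, e v} \<in> E" for u v
  proof -
    obtain X where X: "X \<in> E" "e ` X = e ` {u, v}" using uv(3) surj by (metis image_empty image_iff image_insert)
    then have "X = {u, v}" using inj_onD[OF inj X(2)] assms(2) uv by auto
    then show ?thesis using X(1) by simp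
  qed
  then show ?thesis
    unfolding graph_automorphism_def bij_betw_def
    using assms(4,5) endo_inj_surj[OF assms(1,3,4)] by blast
qed

lemma evacuation_RRSS:
  assumes "sum_list \<mu> = n" "set ws \<subseteq> {1..<length \<mu>}" "simple_product ws = w\<^sub>0 (length \<mu>)"
  shows "evacuation \<mu> ws (RRSS n \<mu> k) = RRSS n \<mu> (int n - k)"
proof -
  have w: "row_word \<mu> \<in> words \<mu>" by (simp add: words_def)
  have "evacuation_word (length \<mu>) ws (row_word \<mu>) = row_word \<mu>"
    using sorted_words[OF evacuation_word_words[OF w assms(2,3)]] evacuation_word_sorted sorted_row_word by blast
  then have "evacuation \<mu> ws (RRSS n \<mu> k) = RRSS n \<mu> (- k)"
    using evacuation_tabloid_of[OF w, of ws k] RRSS_row_word[of \<mu>] assms(1) by simp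
  also have "\<dots> = RRSS n \<mu> (int n - k)" by (rule RRSS_mod[OF assms(1)]) simp
  finally show ?thesis .
qed

text \<open>
  For \<open>n \<ge> 3\<close> Knuth moves are windows, and windows are carried to windows.  For \<open>n = 1\<close> and \<open>n = 2\<close>
  every tabloid is an \<open>RRSS\<close> with \<open>k\<close> congruent to \<open>- k\<close>, so the map is the identity, and type \<open>p\<close>
  coincides with type \<open>n - p - 1\<close>.  For \<open>n = 0\<close> there is only one tabloid.
\<close>

lemma evacuation_is_affine_evacuation:
  assumes "sum_list \<mu> = n" "set ws \<subseteq> {1..<length \<mu>}" "simple_product ws = w\<^sub>0 (length \<mu>)"
  shows "is_affine_evacuation n \<mu> (evacuation \<mu> ws)"
proof -
  let ?d = "length \<mu>" and ?e = "evacuation \<mu> ws" and ?V = "tabloids n \<mu>"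
  have word: "\<exists>w\<in>words \<mu>. T = tabloid_of ?d 0 w" if "T \<in> ?V" for T
    using tabloid_word[OF that assms(1)] .
  have maps: "?e T \<in> ?V" if "T \<in> ?V" for T
    using word[OF that] evacuation_tabloid_of tabloid_of_in_tabloids evacuation_word_words assms by metis
  have inj: "inj_on ?e ?V"
  proof (rule inj_onI)
    fix T S assume TS: "T \<in> ?V" "S \<in> ?V" "?e T = ?e S"
    obtain v w where v: "v \<in> words \<mu>" "T = tabloid_of ?d 0 v" and w: "w \<in> words \<mu>" "S = tabloid_of ?d 0 w"
      using word TS by meson
    have E: "evacuation_word ?d ws v \<in> words \<mu>" using evacuation_word_words v(1) assms by blast
    have "tabloid_of ?d (- 0) (evacuation_word ?d ws v) = tabloid_of ?d (- 0) (evacuation_word ?d ws w)"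
      using evacuation_tabloid_of[OF v(1), of ws 0] evacuation_tabloid_of[OF w(1), of ws 0] TS(3) v(2) w(2)
      by simp
    then have "evacuation_word ?d ws v = evacuation_word ?d ws w"
      by (rule tabloid_of_inject) (use words_length[OF v(1)] words_length[OF w(1)] words_set[OF E] in simp_all)
    then have "v = w" using evacuation_word_inject words_set v(1) w(1) by metis
    then show "T = S" using v w by simp
  qed
  have fixed: "?e S = S" if S: "S \<in> ?V" and "n < 3" for S
  proof -
    obtain k where k: "S = RRSS n \<mu> k" using tabloids_small[OF S assms(1)] \<open>n < 3\<close> by auto
    have "n = 0 \<or> n = 1 \<or> n = 2" using \<open>n < 3\<close> by auto
    then show ?thesis
    proof
      assume "n = 0"
      then show ?thesis using tabloids_0 maps[OF S] S assms(1) by blast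
    next
      assume "n = 1 \<or> n = 2"
      then have "(int n - k) mod int n = k mod int n" by (auto simp: mod_eq_dvd_iff)
      then show ?thesis using evacuation_RRSS[OF assms, of k] RRSS_mod[OF assms(1), of "int n - k" k] k by simp
    qed
  qed
  have typed: "knuth_move_of_type n ((int n - p - 1) mod int n) (?e T) (?e T')"
    if p: "p \<in> {0..<int n}" and T: "T \<in> ?V" "T' \<in> ?V" and move: "knuth_move_of_type n p T T'" for p T T'
  proof (cases "3 \<le> n")
    case True
    have "window_move \<mu> (p + 2) T T'"
      by (rule window_move_if_knuth_move_of_type[OF move T(1) assms(1) True p])
    then have "window_move \<mu> (3 - int n - (p + 2)) (?e T) (?e T')"
      by (rule evacuation_window_move[OF _ assms(2,3,1)])
    from knuth_move_of_type_if_window_move[OF this assms(1)]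
    have "knuth_move_of_type n ((3 - int n - (p + 2) - 2) mod int n) (?e T) (?e T')" .
    moreover have "3 - int n - (p + 2) - 2 = (int n - p - 1) + (- 2) * int n" by simp
    then have "(3 - int n - (p + 2) - 2) mod int n = (int n - p - 1) mod int n"
      by (metis mod_mult_self1)
    ultimately show ?thesis by simp
  next
    case False
    have n: "n = 1 \<or> n = 2" using False p by auto
    then have "(p + 1) mod int n = (int n - p - 1) mod int n" "((int n - p - 1) mod int n + 1) mod int n = p"
      using p by auto presburger+
    then show ?thesis using move fixed[OF T(1)] fixed[OF T(2)] False unfolding knuth_move_of_type_def Let_def by auto
  qed
  have "graph_automorphism ?V (knuth_edges n \<mu>) ?e"
  proof (rule graph_automorphismI)
    show "finite ?V" by (rule finite_tabloids[OF assms(1)])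
    show "knuth_edges n \<mu> \<subseteq> Pow ?V" by (auto simp: knuth_edges_def)
    show "?e ` ?V \<subseteq> ?V" using maps by blast
    show "inj_on ?e ?V" by (rule inj)
    show "\<exists>u v. X = {u, v}" if "X \<in> knuth_edges n \<mu>" for X using that by (auto simp: knuth_edges_def)
    show "{?e u, ?e v} \<in> knuth_edges n \<mu>" if uv: "u \<in> ?V" "v \<in> ?V" "{u, v} \<in> knuth_edges n \<mu>" for u v
    proof -
      have e: "{?e S, ?e S'} \<in> knuth_edges n \<mu>" if S: "S \<in> ?V" "S' \<in> ?V" "knuth_move n S S'" for S S'
      proof (cases "3 \<le> n")
        case True
        then obtain p where p: "p \<in> {0..<int n}" "knuth_move_of_type n p S S'"
          using knuth_move_has_type[OF S(3,1) assms(1)] by blast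
        then have "knuth_move n (?e S) (?e S')" using typed[OF p(1) S(1,2) p(2)] by (simp add: knuth_move_of_type_def)
        then show ?thesis using maps S unfolding knuth_edges_def by blast
      next
        case False
        then show ?thesis using S maps fixed unfolding knuth_edges_def by auto
      qed
      obtain S S' where S: "{u, v} = {S, S'}" "S \<in> ?V" "S' \<in> ?V" "knuth_move n S S'"
        using uv(3) by (auto simp: knuth_edges_def)
      then have "{?e u, ?e v} = {?e S, ?e S'}" by (auto simp: doubleton_eq_iff)
      then show ?thesis using e[OF S(2-4)] by simp
    qed
  qed
  moreover have "?e (RRSS n \<mu> k) = RRSS n \<mu> ((int n - k) mod int n)" for k
    using evacuation_RRSS[OF assms] RRSS_mod[OF assms(1), of "(int n - k) mod int n" "int n - k"] by simp
  ultimately show ?thesis unfolding is_affine_evacuation_def using typed by blast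
qed

lemma affine_evacuation_eq:
  assumes "sum_list \<mu> = n" "set ws \<subseteq> {1..<length \<mu>}" "simple_product ws = w\<^sub>0 (length \<mu>)"
  shows "affine_evacuation n \<mu> = evacuation \<mu> ws"
  unfolding affine_evacuation_def
proof (rule the_equality)
  show "evacuation \<mu> ws \<in> extensional (tabloids n \<mu>) \<and> is_affine_evacuation n \<mu> (evacuation \<mu> ws)"
    using evacuation_is_affine_evacuation[OF assms] assms(1) by (simp add: evacuation_def)
  fix e assume e: "e \<in> extensional (tabloids n \<mu>) \<and> is_affine_evacuation n \<mu> e"
  show "e = evacuation \<mu> ws"
    by (rule extensionalityI[of _ "tabloids n \<mu>"])
      (use e assms(1) affine_evacuation_unique[OF _ evacuation_is_affine_evacuation[OF assms] assms(1)]
        in \<open>auto simp: evacuation_def[of \<mu>]\<close>)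
qed

theorem theorem3p18:
  fixes n :: nat and \<mu> :: "nat list" and T :: "int set list"
  assumes "composition n \<mu>"
    and "T \<in> tabloids n \<mu>"
  shows "R_tabloid n (w\<^sub>0 (length \<mu>)) (complement_entries n (rev T)) = affine_evacuation n \<mu> T"
proof -
  let ?d = "length \<mu>" and ?E = "evacuation_word (length \<mu>)"
  have n: "sum_list \<mu> = n" using assms(1) by (simp add: composition_def)
  obtain w where w: "w \<in> words \<mu>" "T = tabloid_of ?d 0 w" using tabloid_word[OF assms(2) n] by blast
  have len: "length w = n" using words_length[OF w(1)] n by simp
  define v where "v = rev (map (\<lambda>r. ?d - 1 - r) w)"
  have "complement_entries n (rev T) = tabloid_of ?d 0 v"
    using complement_tabloid_of[OF words_set[OF w(1)] len, of 0] by (simp add: v_def w(2))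
  then have tensor: "tabloid_to_tensor n (complement_entries n (rev T)) = tensor_of ?d v"
    using tensor_of_tabloid[of v ?d] len by (simp add: v_def)
  have fold: "fold R_simple ws (tensor_of ?d v) = tensor_of ?d (?E ws w)" if "set ws \<subseteq> {1..<?d}" for ws
    using fold_R_simple[OF that] by (simp add: evacuation_word_def v_def)
  have val: "affine_evacuation n \<mu> T = tabloid_of ?d 0 (?E ws w)" and shape: "?E ws w \<in> words \<mu>"
    if "set ws \<subseteq> {1..<?d}" "simple_product ws = w\<^sub>0 ?d" for ws
    using affine_evacuation_eq[OF n that] evacuation_tabloid_of[OF w(1), of ws 0] w(2)
      evacuation_word_words[OF w(1) that] by simp_all
  obtain js where js: "set js \<subseteq> {1..<?d}" "simple_product js = w\<^sub>0 ?d" using ex_longest_word by blast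
  \<comment> \<open>Both expressions of \<open>w\<^sub>0\<close> compute the affine evacuation, and a tabloid determines its word.\<close>
  have unique: "?E ws w = ?E js w" if "set ws \<subseteq> {1..<?d}" "simple_product ws = w\<^sub>0 ?d" for ws
  proof (rule tabloid_of_inject)
    show "tabloid_of ?d 0 (?E ws w) = tabloid_of ?d 0 (?E js w)" using val[OF that] val[OF js] by simp
    show "set (?E ws w) \<subseteq> {..<?d}" by (rule words_set[OF shape[OF that]])
  qed simp
  have ld: "length (tensor_of ?d v) = ?d" by (simp add: tensor_of_def)
  have "R_perm (w\<^sub>0 ?d) (tensor_of ?d v) = tensor_of ?d (?E js w)"
    unfolding R_perm_def ld
  proof (rule the_equality)
    show "\<exists>ws. set ws \<subseteq> {1..<?d} \<and> simple_product ws = w\<^sub>0 ?d \<and> tensor_of ?d (?E js w) = fold R_simple ws (tensor_of ?d v)"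
      using js fold[OF js(1)] by metis
  next
    fix cs assume "\<exists>ws. set ws \<subseteq> {1..<?d} \<and> simple_product ws = w\<^sub>0 ?d \<and> cs = fold R_simple ws (tensor_of ?d v)"
    then show "cs = tensor_of ?d (?E js w)" using fold unique by auto
  qed
  then show ?thesis
    using tabloid_of_tensor[of "?E js w" ?d] len val[OF js] by (simp add: R_tabloid_def tensor)
qed

end
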